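(* Let $f:\partial\Omega\to\mathbb{R}$ be a bounded $P_\Omega$-measurable function with $\int_{\partial\Omega} f\,dP_\Omega=0$, let \[ I(v)=\int_\Omega g_v^p\,d\mu+\int_{\partial\Omega} Tv\, f\,dP_\Omega ,\qquad v\in N^{1,p}(\Omega), \] let $N^{1,p}_*(\Omega)=\{v\in N^{1,p}(\Omega):\int_\Omega v\,d\mu=0\}$, and let \[ M_I=\Bigl\{u\in N^{1,p}_*(\Omega): I(u)=\inf_{v\in N^{1,p}_*(\Omega)}I(v)\Bigr\}. \] Suppose that $u,v\in M_I$. Then $\int_{\partial\Omega}Tu\,f\,dP_\Omega=\int_{\partial\Omega}Tv\,f\,dP_\Omega$ and $g_u=g_v$ $\mu$-a.e. in $\Omega$. Furthermore, the functions \[ w_+=\max\{u,v\}-\fint_\Omega\max\{u,v\}\,d\mu\quad\text{and}\quad w_-=\min\{u,v\}-\fint_\Omega\min\{u,v\}\,d\mu \] also belong to $M_I$.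
   Context: Setting. $1<p<\infty$ and $(X,d,\mu)$ is a complete metric measure space; $\mu$ is doubling, i.e. there is $C_D$ with $0<\mu(B(z,2r))\le C_D\,\mu(B(z,r))<\infty$ for all $z\in X$, $r>0$. Fix $s>1$ and $C>0$ with $\mu(B(x,r))/\mu(B(y,R))\ge C(r/R)^s$ for all $0<r\le R$, $y\in X$, $x\in B(y,R)$ (such $s$ exists by doubling). A Borel function $g\ge 0$ is an upper gradient of $u$ if $|u(y)-u(x)|\le\int_\gamma g\,ds$ for every rectifiable curve $\gamma$ with end points $x,y$ (the right-hand side being required to be $\infty$ if $u(x)$ or $u(y)$ is not finite); $g$ is a $p$-weak upper gradient if this holds outside a family of curves of zero $p$-modulus; $g_u$ denotes the minimal ($\mu$-a.e. smallest) $p$-weak upper gradient of $u$ in $L^p$. $N^{1,p}$ of a space is the set of (everywhere defined) functions in $L^p$ having an upper gradient in $L^p$, with norm $\|u\|_{L^p}+\inf_g\|g\|_{L^p}$; $N^{1,p}(\Omega)$ is this space for $\Omega$ viewed as a metric measure space, and $g_u$ is then taken in $\Omega$. A space supports a $p$-Poincaré inequality (with dilation $\lambda$) if there is $C$ with $\fint_B|u-u_B|\,d\mu\le C\,\mathrm{rad}(B)\,(\fint_{\lambda B}g^p\,d\mu)^{1/p}$ for all balls $B$, all $u$ integrable on bounded sets, and all upper gradients $g$ of $u$, where $u_B=\fint_B u\,d\mu=\mu(B)^{-1}\int_B u\,d\mu$. $X$ supports a $p$-Poincaré inequality. Perimeter: for open $U\subset X$, $P_E(U)=\inf\{\liminf_k\int_U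 g_{u_k}\,d\mu: u_k\in N^{1,1}(U),\ u_k\to\chi_{E\cap U}\text{ in }L^1(U)\}$; $E$ has finite perimeter if $P_E(X)<\infty$, and then $P_E$ extends to a finite Radon measure on $X$. Domain. $\Omega\subset X$ is a bounded domain (nonempty connected open set) of finite perimeter, $\mu(X\setminus\Omega)>0$, and there is $C\ge1$ such that for all $x\in\partial\Omega$, $z\in\Omega$, $0<r\le\mathrm{diam}(\Omega)$: $\mu(B(z,r)\cap\Omega)\ge C^{-1}\mu(B(z,r))$ and $C^{-1}\mu(B(x,r))/r\le P_\Omega(B(x,r))\le C\mu(B(x,r))/r$. Moreover $(\Omega,d|_\Omega,\mu|_\Omega)$ supports a $p$-Poincaré inequality with $\lambda=1$. Trace. Under these assumptions there is a bounded linear trace operator $T:N^{1,p}(\Omega)\to L^{\tilde p}(\partial\Omega,P_\Omega)$ for every $\tilde p<p^*$, where $p^*=p(s-1)/(s-p)$ if $p<s$ and $p^*=\infty$ if $p\ge s$ ($\tilde p=\infty$ is allowed if $p>s$), determined by $\lim_{r\to0^+}\fint_{B(x,r)\cap\Omega}|u-Tu(x)|\,d\mu=0$ for almost every $x\in\partial\Omega$ with respect to the co-dimension 1 Hausdorff measure. *)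

theory Defs
  imports "HOL-Analysis.Analysis" "HOL-Probability.Essential_Supremum"
begin

text \<open>
  A metric measure space is a carrier set \<open>S\<close> in a metric type together with a Borel measure
  \<open>\<mu>\<close>; curves, balls and functions on it are those of the subspace \<open>S\<close>. Thus \<open>X\<close> is \<^term>\<open>UNIV\<close>,
  and an open set \<open>S\<close> is itself a metric measure space. Functions are extended real valued and
  only their values on \<open>S\<close> matter. Measurable means measurable for the completion of \<open>\<mu>\<close>;
  upper gradients are Borel.
\<close>

definition measure_on :: "'a measure \<Rightarrow> 'a set \<Rightarrow> 'a measure" where
  "measure_on \<mu> S = restrict_space (completion \<mu>) S"

definition ennpowr :: "ennreal \<Rightarrow> real \<Rightarrow> ennreal" where
  "ennpowr a p = (if a = \<infinity> then \<infinity> else ennreal (enn2real a powr p))"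

definition eabs :: "ereal \<Rightarrow> ennreal" where
  "eabs a = e2ennreal \<bar>a\<bar>"

definition Lp_norm :: "'a measure \<Rightarrow> ereal \<Rightarrow> ('a \<Rightarrow> ennreal) \<Rightarrow> ennreal" where
  "Lp_norm M q h =
     (if q = \<infinity> then esssup M h
      else ennpowr (\<integral>\<^sup>+x. ennpowr (h x) (real_of_ereal q) \<partial>M) (1 / real_of_ereal q))"

definition in_Lp :: "'a measure \<Rightarrow> ereal \<Rightarrow> ('a \<Rightarrow> ereal) \<Rightarrow> bool" where
  "in_Lp M q u \<longleftrightarrow> u \<in> borel_measurable M \<and> Lp_norm M q (\<lambda>x. eabs (u x)) < \<infinity>"

definition nn_mean :: "'a measure \<Rightarrow> 'a set \<Rightarrow> ('a \<Rightarrow> ennreal) \<Rightarrow> ennreal" where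
  "nn_mean \<mu> A h = (\<integral>\<^sup>+x. h x \<partial>measure_on \<mu> A) / emeasure \<mu> A"

text \<open>Integrals of extended real valued functions; they are only applied to functions in some
  \<open>L\<^sup>p\<close>, which are finite almost everywhere.\<close>

definition integral_on :: "'a measure \<Rightarrow> 'a set \<Rightarrow> ('a \<Rightarrow> ereal) \<Rightarrow> real" where
  "integral_on \<mu> A u = (LINT x|measure_on \<mu> A. real_of_ereal (u x))"

definition mean :: "'a measure \<Rightarrow> 'a set \<Rightarrow> ('a \<Rightarrow> ereal) \<Rightarrow> real" where
  "mean \<mu> A u = integral_on \<mu> A u / measure \<mu> A"


section \<open>Curves and line integrals\<close>

definition curve_length :: "(real \<Rightarrow> 'a::metric_space) \<Rightarrow> real \<Rightarrow> real \<Rightarrow> ennreal" where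
  "curve_length \<gamma> a b =
     (SUP (n, t) \<in> {(n :: nat, t :: nat \<Rightarrow> real).
          (\<forall>i\<le>n. t i \<in> {a..b}) \<and> (\<forall>i<n. t i \<le> t (Suc i))}.
        \<Sum>i<n. ennreal (dist (\<gamma> (t i)) (\<gamma> (t (Suc i)))))"

text \<open>As usual in this theory, curves are nonconstant; a constant curve at a point where \<open>u\<close> is
  infinite would otherwise violate the upper gradient inequality for every \<open>g\<close>.\<close>

definition rectifiable_curves :: "'a::metric_space set \<Rightarrow> (real \<Rightarrow> 'a) set" where
  "rectifiable_curves S =
     {\<gamma>. path \<gamma> \<and> path_image \<gamma> \<subseteq> S \<and> \<not> \<gamma> constant_on {0..1} \<and> curve_length \<gamma> 0 1 < \<infinity>}"

text \<open>All parameters \<open>t\<close> at which the length of \<open>\<gamma>\<close> up to \<open>t\<close> equals \<open>l\<close> give the same point.\<close>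

definition arclength_param :: "(real \<Rightarrow> 'a::metric_space) \<Rightarrow> real \<Rightarrow> 'a" where
  "arclength_param \<gamma> l = \<gamma> (SOME t. t \<in> {0..1} \<and> curve_length \<gamma> 0 t = ennreal l)"

definition line_integral :: "(real \<Rightarrow> 'a::metric_space) \<Rightarrow> ('a \<Rightarrow> ennreal) \<Rightarrow> ennreal" where
  "line_integral \<gamma> g =
     (\<integral>\<^sup>+l\<in>{0..enn2real (curve_length \<gamma> 0 1)}. g (arclength_param \<gamma> l) \<partial>lborel)"

definition modulus ::
    "'a::metric_space set \<Rightarrow> 'a measure \<Rightarrow> real \<Rightarrow> (real \<Rightarrow> 'a) set \<Rightarrow> ennreal" where
  "modulus S \<mu> p \<Gamma> =
     (INF \<rho> \<in> {\<rho>. \<rho> \<in> borel_measurable (restrict_space borel S) \<and>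
                 (\<forall>\<gamma>\<in>\<Gamma>. 1 \<le> line_integral \<gamma> \<rho>)}.
        \<integral>\<^sup>+x. ennpowr (\<rho> x) p \<partial>measure_on \<mu> S)"


section \<open>Upper gradients and Newtonian spaces\<close>

definition ug_inequality ::
    "('a::metric_space \<Rightarrow> ereal) \<Rightarrow> ('a \<Rightarrow> ennreal) \<Rightarrow> (real \<Rightarrow> 'a) \<Rightarrow> bool" where
  "ug_inequality u g \<gamma> \<longleftrightarrow>
     (if \<bar>u (\<gamma> 0)\<bar> = \<infinity> \<or> \<bar>u (\<gamma> 1)\<bar> = \<infinity> then line_integral \<gamma> g = \<infinity>
      else eabs (u (\<gamma> 1) - u (\<gamma> 0)) \<le> line_integral \<gamma> g)"

definition upper_gradient ::
    "'a::metric_space set \<Rightarrow> ('a \<Rightarrow> ereal) \<Rightarrow> ('a \<Rightarrow> ennreal) \<Rightarrow> bool" where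
  "upper_gradient S u g \<longleftrightarrow>
     g \<in> borel_measurable (restrict_space borel S) \<and>
     (\<forall>\<gamma>\<in>rectifiable_curves S. ug_inequality u g \<gamma>)"

definition weak_upper_gradient ::
    "'a::metric_space set \<Rightarrow> 'a measure \<Rightarrow> real \<Rightarrow> ('a \<Rightarrow> ereal) \<Rightarrow> ('a \<Rightarrow> ennreal) \<Rightarrow> bool" where
  "weak_upper_gradient S \<mu> p u g \<longleftrightarrow>
     g \<in> borel_measurable (restrict_space borel S) \<and>
     (\<exists>\<Gamma>\<subseteq>rectifiable_curves S. modulus S \<mu> p \<Gamma> = 0 \<and>
        (\<forall>\<gamma>\<in>rectifiable_curves S - \<Gamma>. ug_inequality u g \<gamma>))"

definition is_minimal_weak_upper_gradient ::
    "'a::metric_space set \<Rightarrow> 'a measure \<Rightarrow> real \<Rightarrow> ('a \<Rightarrow> ereal) \<Rightarrow> ('a \<Rightarrow> ennreal) \<Rightarrow> bool" where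
  "is_minimal_weak_upper_gradient S \<mu> p u g \<longleftrightarrow>
     weak_upper_gradient S \<mu> p u g \<and> Lp_norm (measure_on \<mu> S) (ereal p) g < \<infinity> \<and>
     (\<forall>h. weak_upper_gradient S \<mu> p u h \<and> Lp_norm (measure_on \<mu> S) (ereal p) h < \<infinity> \<longrightarrow>
        (AE x in measure_on \<mu> S. g x \<le> h x))"

text \<open>The function \<open>g\<^sub>u\<close>, unique up to almost everywhere equality.\<close>

definition min_gradient ::
    "'a::metric_space set \<Rightarrow> 'a measure \<Rightarrow> real \<Rightarrow> ('a \<Rightarrow> ereal) \<Rightarrow> 'a \<Rightarrow> ennreal" where
  "min_gradient S \<mu> p u = (SOME g. is_minimal_weak_upper_gradient S \<mu> p u g)"

definition newtonian ::
    "'a::metric_space set \<Rightarrow> 'a measure \<Rightarrow> real \<Rightarrow> ('a \<Rightarrow> ereal) set" where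
  "newtonian S \<mu> p =
     {u. in_Lp (measure_on \<mu> S) (ereal p) u \<and>
         (\<exists>g. upper_gradient S u g \<and> Lp_norm (measure_on \<mu> S) (ereal p) g < \<infinity>)}"

definition newtonian_norm ::
    "'a::metric_space set \<Rightarrow> 'a measure \<Rightarrow> real \<Rightarrow> ('a \<Rightarrow> ereal) \<Rightarrow> ennreal" where
  "newtonian_norm S \<mu> p u =
     Lp_norm (measure_on \<mu> S) (ereal p) (\<lambda>x. eabs (u x)) +
     (INF g \<in> {g. upper_gradient S u g}. Lp_norm (measure_on \<mu> S) (ereal p) g)"


section \<open>Doubling and the Poincare inequality\<close>

definition doubling :: "'a::metric_space measure \<Rightarrow> bool" where
  "doubling \<mu> \<longleftrightarrow>
     (\<exists>C::real. \<forall>z r. 0 < r \<longrightarrow>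
        0 < emeasure \<mu> (ball z (2 * r)) \<and>
        emeasure \<mu> (ball z (2 * r)) \<le> ennreal C * emeasure \<mu> (ball z r) \<and>
        emeasure \<mu> (ball z r) < \<infinity>)"

definition lower_mass_bound :: "'a::metric_space measure \<Rightarrow> real \<Rightarrow> bool" where
  "lower_mass_bound \<mu> s \<longleftrightarrow>
     (\<exists>C>0. \<forall>r R x y. 0 < r \<and> r \<le> R \<and> x \<in> ball y R \<longrightarrow>
        C * (r / R) powr s \<le> measure \<mu> (ball x r) / measure \<mu> (ball y R))"

definition integrable_on_bounded ::
    "'a::metric_space set \<Rightarrow> 'a measure \<Rightarrow> ('a \<Rightarrow> ereal) \<Rightarrow> bool" where
  "integrable_on_bounded S \<mu> u \<longleftrightarrow>
     u \<in> borel_measurable (measure_on \<mu> S) \<and>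
     (\<forall>A\<in>sets borel. bounded A \<and> A \<subseteq> S \<longrightarrow> (\<integral>\<^sup>+x. eabs (u x) \<partial>measure_on \<mu> A) < \<infinity>)"

definition poincare_inequality ::
    "'a::metric_space set \<Rightarrow> 'a measure \<Rightarrow> real \<Rightarrow> real \<Rightarrow> bool" where
  "poincare_inequality S \<mu> p lam \<longleftrightarrow>
     (\<exists>C::real. \<forall>u g x r.
        integrable_on_bounded S \<mu> u \<and> upper_gradient S u g \<and> x \<in> S \<and> 0 < r \<longrightarrow>
        nn_mean \<mu> (ball x r \<inter> S) (\<lambda>y. eabs (u y - ereal (mean \<mu> (ball x r \<inter> S) u)))
          \<le> ennreal (C * r) *
             ennpowr (nn_mean \<mu> (ball x (lam * r) \<inter> S) (\<lambda>y. ennpowr (g y) p)) (1 / p))"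


section \<open>Perimeter and codimension one Hausdorff measure\<close>

definition perimeter :: "'a::metric_space measure \<Rightarrow> 'a set \<Rightarrow> 'a set \<Rightarrow> ennreal" where
  "perimeter \<mu> E U =
     (INF w \<in> {w :: nat \<Rightarrow> 'a \<Rightarrow> ereal.
                (\<forall>k. w k \<in> newtonian U \<mu> 1) \<and>
                (\<lambda>k. \<integral>\<^sup>+x. eabs (w k x - indicator (E \<inter> U) x) \<partial>measure_on \<mu> U) \<longlonglongrightarrow> 0}.
        liminf (\<lambda>k. \<integral>\<^sup>+x. min_gradient U \<mu> 1 (w k) x \<partial>measure_on \<mu> U))"

text \<open>The Radon measure extending the perimeter from open sets to Borel sets.\<close>

definition perimeter_measure :: "'a::metric_space measure \<Rightarrow> 'a set \<Rightarrow> 'a measure" where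
  "perimeter_measure \<mu> E =
     measure_of UNIV (sets borel) (\<lambda>A. INF U \<in> {U. open U \<and> A \<subseteq> U}. perimeter \<mu> E U)"

definition boundary_measure :: "'a::metric_space measure \<Rightarrow> 'a set \<Rightarrow> 'a measure" where
  "boundary_measure \<mu> \<Omega> = measure_on (perimeter_measure \<mu> \<Omega>) (frontier \<Omega>)"

text \<open>Countable covers are indexed by subsets \<open>I\<close> of the naturals, so finite covers are included.\<close>

definition codim1_content :: "'a::metric_space measure \<Rightarrow> real \<Rightarrow> 'a set \<Rightarrow> ennreal" where
  "codim1_content \<mu> R A =
     (INF (I, c, r) \<in> {(I :: nat set, c :: nat \<Rightarrow> 'a, r :: nat \<Rightarrow> real).
          (\<forall>i\<in>I. 0 < r i \<and> r i \<le> R) \<and> A \<subseteq> (\<Union>i\<in>I. ball (c i) (r i))}.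
        \<Sum>i. if i \<in> I then emeasure \<mu> (ball (c i) (r i)) / ennreal (r i) else 0)"

definition codim1_hausdorff :: "'a::metric_space measure \<Rightarrow> 'a set \<Rightarrow> ennreal" where
  "codim1_hausdorff \<mu> A = (SUP R \<in> {0<..}. codim1_content \<mu> R A)"


section \<open>The domain, the trace and the functional\<close>

definition boundary_regular :: "'a::metric_space measure \<Rightarrow> 'a set \<Rightarrow> bool" where
  "boundary_regular \<mu> \<Omega> \<longleftrightarrow>
     (\<exists>C\<ge>1. \<forall>r. 0 < r \<and> r \<le> diameter \<Omega> \<longrightarrow>
        (\<forall>z\<in>\<Omega>. measure \<mu> (ball z r) / C \<le> measure \<mu> (ball z r \<inter> \<Omega>)) \<and>
        (\<forall>x\<in>frontier \<Omega>.
           ennreal (measure \<mu> (ball x r) / (C * r)) \<le> perimeter \<mu> \<Omega> (ball x r) \<and>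
           perimeter \<mu> \<Omega> (ball x r) \<le> ennreal (C * measure \<mu> (ball x r) / r)))"

definition trace_exponent :: "real \<Rightarrow> real \<Rightarrow> ereal \<Rightarrow> bool" where
  "trace_exponent p s q \<longleftrightarrow>
     1 \<le> q \<and>
     (q < (if p < s then ereal (p * (s - 1) / (s - p)) else \<infinity>) \<or> (q = \<infinity> \<and> p > s))"

text \<open>Linearity is stated for almost everywhere representatives, since pointwise linear combinations
  of extended real valued functions need not be defined everywhere.\<close>

definition is_trace_operator ::
    "'a::metric_space measure \<Rightarrow> 'a set \<Rightarrow> real \<Rightarrow> real \<Rightarrow> (('a \<Rightarrow> ereal) \<Rightarrow> 'a \<Rightarrow> real) \<Rightarrow> bool" where
  "is_trace_operator \<mu> \<Omega> p s T \<longleftrightarrow>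
     (\<forall>u\<in>newtonian \<Omega> \<mu> p.
        codim1_hausdorff \<mu> {x \<in> frontier \<Omega>.
          \<not> ((\<lambda>r. nn_mean \<mu> (ball x r \<inter> \<Omega>) (\<lambda>y. eabs (u y - ereal (T u x)))) \<longlongrightarrow> 0)
              (at_right 0)} = 0) \<and>
     (\<forall>u\<in>newtonian \<Omega> \<mu> p. \<forall>v\<in>newtonian \<Omega> \<mu> p. \<forall>w\<in>newtonian \<Omega> \<mu> p. \<forall>a b :: real.
        (AE x in measure_on \<mu> \<Omega>. w x = ereal a * u x + ereal b * v x) \<longrightarrow>
        (AE x in boundary_measure \<mu> \<Omega>. T w x = a * T u x + b * T v x)) \<and>
     (\<forall>q. trace_exponent p s q \<longrightarrow>
        (\<forall>u\<in>newtonian \<Omega> \<mu> p. in_Lp (boundary_measure \<mu> \<Omega>) q (\<lambda>x. ereal (T u x))) \<and>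
        (\<exists>K::real. \<forall>u\<in>newtonian \<Omega> \<mu> p.
           Lp_norm (boundary_measure \<mu> \<Omega>) q (\<lambda>x. ennreal \<bar>T u x\<bar>)
             \<le> ennreal K * newtonian_norm \<Omega> \<mu> p u))"

definition boundary_integral :: "'a::metric_space measure \<Rightarrow> 'a set \<Rightarrow> ('a \<Rightarrow> real) \<Rightarrow> real" where
  "boundary_integral \<mu> \<Omega> h = (LINT x|boundary_measure \<mu> \<Omega>. h x)"

definition energy ::
    "'a::metric_space measure \<Rightarrow> 'a set \<Rightarrow> real \<Rightarrow> (('a \<Rightarrow> ereal) \<Rightarrow> 'a \<Rightarrow> real) \<Rightarrow>
     ('a \<Rightarrow> real) \<Rightarrow> ('a \<Rightarrow> ereal) \<Rightarrow> real" where
  "energy \<mu> \<Omega> p T f v =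
     enn2real (\<integral>\<^sup>+x. ennpowr (min_gradient \<Omega> \<mu> p v x) p \<partial>measure_on \<mu> \<Omega>) +
     boundary_integral \<mu> \<Omega> (\<lambda>x. T v x * f x)"

definition newtonian_mean_zero ::
    "'a::metric_space set \<Rightarrow> 'a measure \<Rightarrow> real \<Rightarrow> ('a \<Rightarrow> ereal) set" where
  "newtonian_mean_zero \<Omega> \<mu> p = {v \<in> newtonian \<Omega> \<mu> p. integral_on \<mu> \<Omega> v = 0}"

text \<open>The infimum is taken in the extended reals, so that it is meaningful without assuming that
  the functional is bounded below.\<close>

definition minimizers ::
    "'a::metric_space measure \<Rightarrow> 'a set \<Rightarrow> real \<Rightarrow> (('a \<Rightarrow> ereal) \<Rightarrow> 'a \<Rightarrow> real) \<Rightarrow>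
     ('a \<Rightarrow> real) \<Rightarrow> ('a \<Rightarrow> ereal) set" where
  "minimizers \<mu> \<Omega> p T f =
     {u \<in> newtonian_mean_zero \<Omega> \<mu> p.
        ereal (energy \<mu> \<Omega> p T f u) =
          (INF v \<in> newtonian_mean_zero \<Omega> \<mu> p. ereal (energy \<mu> \<Omega> p T f v))}"

end

theory Submission
  imports Defs
begin

text \<open>
  The function \<open>z = (u + v) / 2\<close> has \<open>g\<^sub>z \<le> (g\<^sub>u + g\<^sub>v) / 2\<close>, so strict convexity of \<open>t\<^sup>p\<close> and minimality
  force \<open>g\<^sub>u = g\<^sub>v\<close>, and then the boundary terms agree because the energies do. The gradients of
  \<open>w\<^sub>+\<close> and \<open>w\<^sub>-\<close> are at most \<open>max g\<^sub>u g\<^sub>v = g\<^sub>u\<close>, and \<open>w\<^sub>+ + w\<^sub>- = u + v\<close> because \<open>u\<close> and \<open>v\<close> have mean zero;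
  hence \<open>I(w\<^sub>+) + I(w\<^sub>-) \<le> I(u) + I(v)\<close> and both are minimizers.

  Minimal weak upper gradients exist because the weak upper gradients in \<open>L\<^sup>p\<close> are closed under
  pointwise minima and decreasing limits. For minima, \<open>u\<close> along a curve parametrized by arc length
  has increments bounded by the integrals of \<open>g\<close> and of \<open>h\<close> over every subinterval, hence by the
  integral of \<open>min g h\<close>.
\<close>

section \<open>Arc length\<close>

text \<open>\<open>min_gradient\<close> is a choice by \<open>SOME\<close>, so nothing can be said
  about g_u until a minimal weak upper gradient is known to exist; most of the development serves
  that purpose. In the midpoint argument the boundary term is linear, so minimality at z leaves no
  slack in the integrated convexity inequality; as this inequality also holds pointwise, it must be
  an equality almost everywhere. The equality g_u = g_v is proved first because it collapses the
  bound max g_u g_v for both w_+ and w_- to g_u. Their boundary terms are controlled only through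
  the sum; each function is a minimizer because neither energy can lie below the minimum. Functions
  may take infinite values, so real increments along a curve make sense only where the line
  integrals of the gradients are finite. For this reason the weights that exclude exceptional curves
  are also made to control the gradients themselves.\<close>

lemma sum_dist_le_curve_length:
  assumes "\<And>i. i \<le> n \<Longrightarrow> t i \<in> {a..b}" "\<And>i. i < n \<Longrightarrow> t i \<le> t (Suc i)"
  shows "(\<Sum>i<n. ennreal (dist (\<gamma> (t i)) (\<gamma> (t (Suc i))))) \<le> curve_length \<gamma> a b"
  unfolding curve_length_def by (rule SUP_upper2[of "(n, t)"]) (use assms in auto)

lemma curve_length_leI:
  assumes "\<And>n t. (\<And>i. i \<le> n \<Longrightarrow> t i \<in> {a..b}) \<Longrightarrow> (\<And>i. i < n \<Longrightarrow> t i \<le> t (Suc i))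
     \<Longrightarrow> (\<Sum>i<n. ennreal (dist (\<gamma> (t i)) (\<gamma> (t (Suc i))))) \<le> X"
  shows "curve_length \<gamma> a b \<le> X"
  unfolding curve_length_def by (rule SUP_least) (use assms in auto)

lemma dist_le_curve_length:
  assumes "a \<le> b"
  shows "ennreal (dist (\<gamma> a) (\<gamma> b)) \<le> curve_length \<gamma> a b"
  using sum_dist_le_curve_length[of 1 "\<lambda>i. if i = 0 then a else b" a b \<gamma>] assms by auto

text \<open>Clamping a partition at \<open>b\<close> from above and from below yields one partition
  of each part; only a step that straddles \<open>b\<close> changes, and the triangle inequality
  bounds it by its two pieces. Conversely, partitions of the two parts are concatenated.\<close>

lemma curve_length_add:
  assumes "a \<le> b" "b \<le> c"
  shows "curve_length \<gamma> a c = curve_length \<gamma> a b + curve_length \<gamma> b c"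
proof (rule antisym)
  show "curve_length \<gamma> a c \<le> curve_length \<gamma> a b + curve_length \<gamma> b c"
  proof (rule curve_length_leI)
    fix n and t :: "nat \<Rightarrow> real"
    assume t: "\<And>i. i \<le> n \<Longrightarrow> t i \<in> {a..c}" and mono: "\<And>i. i < n \<Longrightarrow> t i \<le> t (Suc i)"
    let ?d = "\<lambda>t i. ennreal (dist (\<gamma> (t i)) (\<gamma> (t (Suc i))))"
    let ?l = "\<lambda>i. min (t i) b" and ?r = "\<lambda>i. max (t i) b"
    have "?d t i \<le> ?d ?l i + ?d ?r i" if "i < n" for i
    proof -
      have "dist (\<gamma> (t i)) (\<gamma> (t (Suc i)))
          \<le> dist (\<gamma> (?l i)) (\<gamma> (?l (Suc i))) + dist (\<gamma> (?r i)) (\<gamma> (?r (Suc i)))"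
        using mono[OF that] dist_triangle[of "\<gamma> (t i)" "\<gamma> (t (Suc i))" "\<gamma> b"]
        by (auto simp: min_def max_def)
      then show ?thesis
        by (simp flip: ennreal_plus)
    qed
    then have "(\<Sum>i<n. ?d t i) \<le> (\<Sum>i<n. ?d ?l i) + (\<Sum>i<n. ?d ?r i)"
      unfolding sum.distrib[symmetric] by (intro sum_mono) simp
    also have "\<dots> \<le> curve_length \<gamma> a b + curve_length \<gamma> b c"
    proof (rule add_mono)
      show "(\<Sum>i<n. ?d ?l i) \<le> curve_length \<gamma> a b"
      proof (rule sum_dist_le_curve_length)
        show "?l i \<in> {a..b}" if "i \<le> n" for i using t[OF that] assms by auto
        show "?l i \<le> ?l (Suc i)" if "i < n" for i using mono[OF that] by auto
      qed
      show "(\<Sum>i<n. ?d ?r i) \<le> curve_length \<gamma> b c"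
      proof (rule sum_dist_le_curve_length)
        show "?r i \<in> {b..c}" if "i \<le> n" for i using t[OF that] assms by auto
        show "?r i \<le> ?r (Suc i)" if "i < n" for i using mono[OF that] by auto
      qed
    qed
    finally show "(\<Sum>i<n. ?d t i) \<le> curve_length \<gamma> a b + curve_length \<gamma> b c" .
  qed
next
  let ?d = "\<lambda>t i. ennreal (dist (\<gamma> (t i)) (\<gamma> (t (Suc i))))"
  let ?P = "\<lambda>a b. {(n :: nat, t :: nat \<Rightarrow> real).
          (\<forall>i\<le>n. t i \<in> {a..b}) \<and> (\<forall>i<n. t i \<le> t (Suc i))}"
  have pair: "(\<Sum>i<n. ?d t i) + (\<Sum>i<m. ?d s i) \<le> curve_length \<gamma> a c"
    if nt: "(n, t) \<in> ?P a b" and ms: "(m, s) \<in> ?P b c" for n t m s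
  proof -
    \<comment> \<open>The shift by \<open>Suc n\<close> keeps both \<open>t n\<close> and
      \<open>s 0\<close>, which may differ; the extra step between them only enlarges the
      sum.\<close>
    define r where "r i = (if i \<le> n then t i else s (i - Suc n))" for i
    have "(\<Sum>i<n. ?d t i) + (\<Sum>i<m. ?d s i)
        = (\<Sum>i\<in>{..<n}. ?d r i) + (\<Sum>i\<in>{Suc n..<Suc n + m}. ?d r i)"
    proof -
      have "(\<Sum>i\<in>{Suc n..<Suc n + m}. ?d r i) = (\<Sum>i<m. ?d s i)"
        by (rule sum.reindex_bij_witness[of _ "\<lambda>i. i + Suc n" "\<lambda>i. i - Suc n"])
          (auto simp: r_def Suc_diff_Suc)
      moreover have "(\<Sum>i\<in>{..<n}. ?d r i) = (\<Sum>i<n. ?d t i)"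
        by (rule sum.cong) (auto simp: r_def)
      ultimately show ?thesis by simp
    qed
    also have "\<dots> = (\<Sum>i\<in>{..<n} \<union> {Suc n..<Suc n + m}. ?d r i)"
      by (rule sum.union_disjoint[symmetric]) auto
    also have "\<dots> \<le> (\<Sum>i<Suc n + m. ?d r i)"
      by (rule sum_mono2) auto
    also have "\<dots> \<le> curve_length \<gamma> a c"
    proof (rule sum_dist_le_curve_length)
      show "r i \<in> {a..c}" if "i \<le> Suc n + m" for i
      proof (cases "i \<le> n")
        case True
        then have "t i \<in> {a..b}" using nt by auto
        then show ?thesis using True assms by (auto simp: r_def)
      next
        case False
        then have "s (i - Suc n) \<in> {b..c}" using ms that by auto
        then show ?thesis using False assms by (auto simp: r_def)
      qed
      show "r i \<le> r (Suc i)" if "i < Suc n + m" for i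
      proof -
        consider "i < n" | "i = n" | "n < i" by linarith
        then show ?thesis
        proof cases
          case 1
          then show ?thesis using nt by (auto simp: r_def)
        next
          case 2
          have "t n \<in> {a..b}" "s 0 \<in> {b..c}" using nt ms by auto
          then show ?thesis using 2 by (auto simp: r_def)
        next
          case 3
          then have "s (i - Suc n) \<le> s (Suc (i - Suc n))" using ms that by auto
          then show ?thesis using 3 by (auto simp: r_def Suc_diff_Suc)
        qed
      qed
    qed
    finally show ?thesis .
  qed
  have "(\<Sum>i<n. ?d t i) + curve_length \<gamma> b c \<le> curve_length \<gamma> a c"
    if nt: "(n, t) \<in> ?P a b" for n t
  proof -
    \<comment> \<open>The constant partition at \<open>b\<close> without steps is a member. A
      supremum commutes with adding a constant only over a nonempty index set.\<close>
    have ne: "?P b c \<noteq> {}" using assms by (auto intro!: exI[of _ 0] exI[of _ "\<lambda>_. b"])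
    show ?thesis
      unfolding curve_length_def[of _ b c] ennreal_SUP_add_right[OF ne]
      by (rule SUP_least) (use pair[OF that] in auto)
  qed
  moreover have ne: "?P a b \<noteq> {}" using assms by (auto intro!: exI[of _ 0] exI[of _ "\<lambda>_. b"])
  ultimately show "curve_length \<gamma> a b + curve_length \<gamma> b c \<le> curve_length \<gamma> a c"
    unfolding curve_length_def[of _ a b] ennreal_SUP_add_left[OF ne, symmetric]
    by (intro SUP_least) auto
qed

text \<open>Clamping the parameters of a nearly optimal partition to \<open>[\<alpha> x, \<beta> x]\<close> gives a lower bound that
  is continuous in \<open>x\<close>. Applied to \<open>[0, x]\<close> and to \<open>[x, 1]\<close>, this bounds the length up to \<open>x\<close> from
  below and, by additivity, from above.\<close>

lemma curve_length_lsc: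
  assumes "path \<gamma>" "continuous_on {0..1} \<alpha>" "continuous_on {0..1} \<beta>"
    and range: "\<And>x. x \<in> {0..1} \<Longrightarrow> 0 \<le> \<alpha> x \<and> \<alpha> x \<le> \<beta> x \<and> \<beta> x \<le> 1"
    and "x0 \<in> {0..1}" "y < curve_length \<gamma> (\<alpha> x0) (\<beta> x0)"
  shows "\<forall>\<^sub>F x in at x0 within {0..1}. y < curve_length \<gamma> (\<alpha> x) (\<beta> x)"
proof -
  obtain n t where t: "\<And>i. i \<le> n \<Longrightarrow> t i \<in> {\<alpha> x0..\<beta> x0}" and mono: "\<And>i. i < n \<Longrightarrow> t i \<le> t (Suc i)"
    and y: "y < (\<Sum>i<n. ennreal (dist (\<gamma> (t i)) (\<gamma> (t (Suc i)))))"
    using assms(6) unfolding curve_length_def less_SUP_iff by auto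
  \<comment> \<open>At \<open>x0\<close> clamping leaves the chosen partition unchanged, so
    \<open>F x0\<close> is the sum that exceeds \<open>y\<close>.\<close>
  define c where "c x i = max (\<alpha> x) (min (\<beta> x) (t i))" for x i
  define F where "F x = (\<Sum>i<n. dist (\<gamma> (c x i)) (\<gamma> (c x (Suc i))))" for x
  have F_le: "ennreal (F x) \<le> curve_length \<gamma> (\<alpha> x) (\<beta> x)" if "x \<in> {0..1}" for x
  proof -
    have "(\<Sum>i<n. ennreal (dist (\<gamma> (c x i)) (\<gamma> (c x (Suc i))))) \<le> curve_length \<gamma> (\<alpha> x) (\<beta> x)"
    proof (rule sum_dist_le_curve_length)
      show "c x i \<in> {\<alpha> x..\<beta> x}" for i using range[OF that] by (auto simp: c_def)
      show "c x i \<le> c x (Suc i)" if "i < n" for i using mono[OF that] by (auto simp: c_def)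
    qed
    then show ?thesis by (simp add: F_def)
  qed
  have "continuous_on {0..1} (\<lambda>x. \<gamma> (c x i))" for i
  proof (rule continuous_on_compose2[of "{0..1}" \<gamma>])
    show "continuous_on {0..1} \<gamma>" using assms(1) by (simp add: path_def)
    show "continuous_on {0..1} (\<lambda>x. c x i)"
      unfolding c_def using assms(2,3) by (intro continuous_intros)
    show "(\<lambda>x. c x i) ` {0..1} \<subseteq> {0..1}"
      using range by (fastforce simp: c_def le_max_iff_disj min_le_iff_disj)
  qed
  then have "continuous_on {0..1} (\<lambda>x. ennreal (F x))"
    unfolding F_def by (intro continuous_intros continuous_on_ennreal) auto
  then have "((\<lambda>x. ennreal (F x)) \<longlongrightarrow> ennreal (F x0)) (at x0 within {0..1})"
    using assms(5) by (auto simp: continuous_on_def)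
  moreover have "c x0 i = t i" if "i \<le> n" for i using t[OF that] by (auto simp: c_def)
  then have "ennreal (F x0) = (\<Sum>i<n. ennreal (dist (\<gamma> (t i)) (\<gamma> (t (Suc i)))))"
    by (simp add: F_def)
  ultimately have "\<forall>\<^sub>F x in at x0 within {0..1}. y < ennreal (F x)"
    using y by (auto intro: order_tendstoD)
  moreover have "\<forall>\<^sub>F x in at x0 within {0..1}. x \<in> {0..1}"
    by (auto simp: eventually_at_filter)
  ultimately show ?thesis
    by eventually_elim (use F_le less_le_trans in blast)
qed

section \<open>Finiteness and continuity of the length function\<close>

lemma curve_length_finite:
  assumes "curve_length \<gamma> 0 1 < \<infinity>" "0 \<le> a" "a \<le> b" "b \<le> 1"
  shows "curve_length \<gamma> a b < \<infinity>"
  using assms curve_length_add[of 0 a 1 \<gamma>] curve_length_add[of a b 1 \<gamma>]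
  by (auto simp: less_top)

lemma continuous_on_curve_length:
  assumes "path \<gamma>" and fin: "curve_length \<gamma> 0 1 < \<infinity>"
  shows "continuous_on {0..1} (\<lambda>t. enn2real (curve_length \<gamma> 0 t))"
  unfolding continuous_on_def
proof (intro ballI order_tendstoI)
  fix t0 y :: real
  assume t0: "t0 \<in> {0..1}"
  have ev: "\<forall>\<^sub>F x in at t0 within {0..1}. x \<in> {0..1}"
    by (auto simp: eventually_at_filter)
  have eq: "ennreal (enn2real (curve_length \<gamma> a b)) = curve_length \<gamma> a b"
    if "0 \<le> a" "a \<le> b" "b \<le> 1" for a b
    using curve_length_finite[OF fin that] by (simp add: less_top)
  { assume y: "y < enn2real (curve_length \<gamma> 0 t0)"
    show "\<forall>\<^sub>F x in at t0 within {0..1}. y < enn2real (curve_length \<gamma> 0 x)"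
    proof (cases "0 \<le> y")
      case True
      have "ennreal y < curve_length \<gamma> 0 t0"
        using True y t0 by (subst eq[symmetric]) (auto simp: ennreal_less_iff)
      then have "\<forall>\<^sub>F x in at t0 within {0..1}. ennreal y < curve_length \<gamma> 0 x"
        using t0 assms by (intro curve_length_lsc[of \<gamma> "\<lambda>_. 0" "\<lambda>x. x"]) (auto intro!: continuous_intros)
      with ev show ?thesis
      proof eventually_elim
        case (elim x)
        then show ?case using True eq[of 0 x] by (metis atLeastAtMost_iff ennreal_less_iff order_refl)
      qed
    next
      case False
      then show ?thesis by (auto intro!: always_eventually simp: not_le intro: less_le_trans[OF _ enn2real_nonneg])
    qed }
  { assume y: "enn2real (curve_length \<gamma> 0 t0) < y"
    define Y where "Y = enn2real (curve_length \<gamma> 0 1) - y"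
    have sum: "enn2real (curve_length \<gamma> 0 1) = enn2real (curve_length \<gamma> 0 x) + enn2real (curve_length \<gamma> x 1)"
      if "x \<in> {0..1}" for x
      using that curve_length_add[of 0 x 1 \<gamma>] curve_length_finite[OF fin, of 0 x]
        curve_length_finite[OF fin, of x 1] by (simp add: enn2real_plus)
    have Y: "Y < enn2real (curve_length \<gamma> t0 1)" using y sum[OF t0] by (simp add: Y_def)
    have "\<forall>\<^sub>F x in at t0 within {0..1}. Y < enn2real (curve_length \<gamma> x 1)"
    proof (cases "0 \<le> Y")
      case True
      have "ennreal Y < curve_length \<gamma> t0 1"
        using True Y t0 by (subst eq[symmetric]) (auto simp: ennreal_less_iff)
      then have "\<forall>\<^sub>F x in at t0 within {0..1}. ennreal Y < curve_length \<gamma> x 1"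
        using t0 assms by (intro curve_length_lsc[of \<gamma> "\<lambda>x. x" "\<lambda>_. 1"]) (auto intro!: continuous_intros)
      with ev show ?thesis
      proof eventually_elim
        case (elim x)
        then show ?case using True eq[of x 1] by (metis atLeastAtMost_iff ennreal_less_iff order_refl)
      qed
    next
      case False
      then show ?thesis by (auto intro!: always_eventually simp: not_le intro: less_le_trans[OF _ enn2real_nonneg])
    qed
    with ev show "\<forall>\<^sub>F x in at t0 within {0..1}. enn2real (curve_length \<gamma> 0 x) < y"
      by eventually_elim (use sum in \<open>fastforce simp: Y_def\<close>) }
qed

text \<open>If the lengths up to two parameters agree, finiteness allows cancellation, so the piece
  between them has length zero and its ends coincide. The choice made by \<open>SOME\<close> is
  therefore immaterial.\<close>

lemma arclength_param_eq:
  assumes fin: "curve_length \<gamma> 0 1 < \<infinity>" and "t \<in> {0..1}" "curve_length \<gamma> 0 t = ennreal l"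
  shows "arclength_param \<gamma> l = \<gamma> t"
proof -
  have *: "\<gamma> s = \<gamma> t" if "s \<in> {0..1}" "t \<in> {0..1}" "s \<le> t" "curve_length \<gamma> 0 s = curve_length \<gamma> 0 t" for s t
  proof -
    have "curve_length \<gamma> 0 t = curve_length \<gamma> 0 s + curve_length \<gamma> s t"
      using that by (intro curve_length_add) auto
    then have "curve_length \<gamma> s t = 0"
      using that curve_length_finite[OF fin, of 0 s]
      by (metis add.right_neutral atLeastAtMost_iff ennreal_add_left_cancel infinity_ennreal_def less_irrefl order_refl)
    then show ?thesis using dist_le_curve_length[OF that(3), of \<gamma>] by simp
  qed
  define s where "s = (SOME t. t \<in> {0..1} \<and> curve_length \<gamma> 0 t = ennreal l)"
  have "s \<in> {0..1} \<and> curve_length \<gamma> 0 s = ennreal l"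
    unfolding s_def by (rule someI[of _ t]) (use assms in auto)
  then have "\<gamma> s = \<gamma> t" using *[of s t] *[of t s] assms by (metis linear)
  then show ?thesis by (simp add: arclength_param_def s_def)
qed

text \<open>The intermediate value theorem for the length function, which is continuous and starts
  at 0. It guarantees that the \<open>SOME\<close> in \<open>arclength_param\<close> has a
  witness.\<close>

lemma curve_length_surj:
  assumes "path \<gamma>" "curve_length \<gamma> 0 1 < \<infinity>" "l \<in> {0..enn2real (curve_length \<gamma> 0 1)}"
  obtains t where "t \<in> {0..1}" "curve_length \<gamma> 0 t = ennreal l"
proof -
  have "curve_length \<gamma> 0 0 \<le> 0"
  proof (rule curve_length_leI)
    fix n and t :: "nat \<Rightarrow> real" assume "\<And>i. i \<le> n \<Longrightarrow> t i \<in> {0..0}"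
    then have "t i = 0" if "i \<le> n" for i using that by force
    then show "(\<Sum>i<n. ennreal (dist (\<gamma> (t i)) (\<gamma> (t (Suc i))))) \<le> 0" by simp
  qed
  then have "enn2real (curve_length \<gamma> 0 0) = 0" by simp
  then obtain t where t: "0 \<le> t" "t \<le> 1" "enn2real (curve_length \<gamma> 0 t) = l"
    using IVT'[of "\<lambda>t. enn2real (curve_length \<gamma> 0 t)" 0 l 1] continuous_on_curve_length[OF assms(1,2)] assms(3)
    by auto
  then have "curve_length \<gamma> 0 t = ennreal l"
    using curve_length_finite[OF assms(2), of 0 t] by (auto simp: less_top)
  with t show thesis by (intro that) auto
qed

text \<open>The piece between arc lengths l < m has length m - l, and a chord is no longer than its
  arc. The continuity obtained here is what makes Borel functions measurable along the
  curve.\<close>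

lemma arclength_param_lipschitz:
  assumes "path \<gamma>" "curve_length \<gamma> 0 1 < \<infinity>"
  shows "1-lipschitz_on {0..enn2real (curve_length \<gamma> 0 1)} (arclength_param \<gamma>)"
proof (rule lipschitz_onI)
  have *: "dist (arclength_param \<gamma> l) (arclength_param \<gamma> m) \<le> m - l"
    if lm: "l \<in> {0..enn2real (curve_length \<gamma> 0 1)}" "m \<in> {0..enn2real (curve_length \<gamma> 0 1)}" "l < m" for l m
  proof -
    obtain s where s: "s \<in> {0..1}" "curve_length \<gamma> 0 s = ennreal l"
      using curve_length_surj[OF assms lm(1)] .
    obtain t where t: "t \<in> {0..1}" "curve_length \<gamma> 0 t = ennreal m"
      using curve_length_surj[OF assms lm(2)] .
    have "s \<le> t"
    proof (rule ccontr)
      assume "\<not> s \<le> t"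
      then have "curve_length \<gamma> 0 s = curve_length \<gamma> 0 t + curve_length \<gamma> t s"
        using s t by (intro curve_length_add) auto
      then have "ennreal m \<le> ennreal l" using s t by simp
      then show False using lm by auto
    qed
    then have "ennreal m = ennreal l + curve_length \<gamma> s t"
      using s t curve_length_add[of 0 s t \<gamma>] by auto
    then have "ennreal l + curve_length \<gamma> s t = ennreal l + ennreal (m - l)"
      using lm by (simp flip: ennreal_plus)
    then have "curve_length \<gamma> s t = ennreal (m - l)"
      by (simp add: ennreal_add_left_cancel)
    then have "dist (\<gamma> s) (\<gamma> t) \<le> m - l"
      using dist_le_curve_length[OF \<open>s \<le> t\<close>, of \<gamma>] lm by (simp add: ennreal_le_iff)
    then show ?thesis
      using arclength_param_eq[OF assms(2) s] arclength_param_eq[OF assms(2) t] by simp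
  qed
  fix l m assume lm: "l \<in> {0..enn2real (curve_length \<gamma> 0 1)}" "m \<in> {0..enn2real (curve_length \<gamma> 0 1)}"
  show "dist (arclength_param \<gamma> l) (arclength_param \<gamma> m) \<le> 1 * dist l m"
    using *[OF lm] *[OF lm(2,1)] by (cases l m rule: linorder_cases) (auto simp: dist_real_def dist_commute)
qed simp

section \<open>Affine reparametrization, end points and subcurves\<close>

lemma curve_length_affine:
  assumes "0 < k"
  shows "curve_length (\<lambda>t. \<gamma> (a + k * t)) x y = curve_length \<gamma> (a + k * x) (a + k * y)"
proof (rule antisym)
  show "curve_length (\<lambda>t. \<gamma> (a + k * t)) x y \<le> curve_length \<gamma> (a + k * x) (a + k * y)"
  proof (rule curve_length_leI)
    fix n and t :: "nat \<Rightarrow> real"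
    assume "\<And>i. i \<le> n \<Longrightarrow> t i \<in> {x..y}" "\<And>i. i < n \<Longrightarrow> t i \<le> t (Suc i)"
    then show "(\<Sum>i<n. ennreal (dist (\<gamma> (a + k * t i)) (\<gamma> (a + k * t (Suc i)))))
        \<le> curve_length \<gamma> (a + k * x) (a + k * y)"
      using assms by (intro sum_dist_le_curve_length[of n "\<lambda>i. a + k * t i"]) auto
  qed
  show "curve_length \<gamma> (a + k * x) (a + k * y) \<le> curve_length (\<lambda>t. \<gamma> (a + k * t)) x y"
  proof (rule curve_length_leI)
    fix n and t :: "nat \<Rightarrow> real"
    assume "\<And>i. i \<le> n \<Longrightarrow> t i \<in> {a + k * x..a + k * y}" "\<And>i. i < n \<Longrightarrow> t i \<le> t (Suc i)"
    then show "(\<Sum>i<n. ennreal (dist (\<gamma> (t i)) (\<gamma> (t (Suc i))))) \<le> curve_length (\<lambda>t. \<gamma> (a + k * t)) x y"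
      using assms sum_dist_le_curve_length[of n "\<lambda>i. (t i - a) / k" x y "\<lambda>t. \<gamma> (a + k * t)"]
      by (auto simp: field_simps)
  qed
qed

lemma rectifiable_curve_length_pos:
  assumes "\<gamma> \<in> rectifiable_curves S"
  shows "0 < enn2real (curve_length \<gamma> 0 1)"
proof -
  have fin: "curve_length \<gamma> 0 1 < \<infinity>" and nc: "\<not> \<gamma> constant_on {0..1}"
    using assms by (auto simp: rectifiable_curves_def)
  have "curve_length \<gamma> 0 1 \<noteq> 0"
  proof
    assume 0: "curve_length \<gamma> 0 1 = 0"
    have "\<gamma> t = \<gamma> 0" if t: "t \<in> {0..1}" for t
    proof -
      have "curve_length \<gamma> 0 t = 0" using t curve_length_add[of 0 t 1 \<gamma>] 0 by auto
      then show ?thesis using dist_le_curve_length[of 0 t \<gamma>] t by simp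
    qed
    then show False using nc unfolding constant_on_def by blast
  qed
  then show ?thesis using fin
    by (metis enn2real_positive_iff infinity_ennreal_def not_gr_zero)
qed

lemma arclength_param_ends:
  assumes "\<gamma> \<in> rectifiable_curves S"
  shows "arclength_param \<gamma> 0 = \<gamma> 0" "arclength_param \<gamma> (enn2real (curve_length \<gamma> 0 1)) = \<gamma> 1"
proof -
  have fin: "curve_length \<gamma> 0 1 < \<infinity>" and pth: "path \<gamma>"
    using assms by (auto simp: rectifiable_curves_def)
  obtain t where t: "t \<in> {0..1}" "curve_length \<gamma> 0 t = ennreal 0"
    using curve_length_surj[OF pth fin, of 0] by auto
  have "\<gamma> t = \<gamma> 0" using dist_le_curve_length[of 0 t \<gamma>] t by simp
  then show "arclength_param \<gamma> 0 = \<gamma> 0" using arclength_param_eq[OF fin t] by simp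
  show "arclength_param \<gamma> (enn2real (curve_length \<gamma> 0 1)) = \<gamma> 1"
    using fin by (intro arclength_param_eq) auto
qed

lemma arclength_param_in:
  assumes "\<gamma> \<in> rectifiable_curves S" "l \<in> {0..enn2real (curve_length \<gamma> 0 1)}"
  shows "arclength_param \<gamma> l \<in> S"
proof -
  have fin: "curve_length \<gamma> 0 1 < \<infinity>" and pth: "path \<gamma>" and sub: "path_image \<gamma> \<subseteq> S"
    using assms by (auto simp: rectifiable_curves_def)
  obtain t where t: "t \<in> {0..1}" "curve_length \<gamma> 0 t = ennreal l"
    using curve_length_surj[OF pth fin assms(2)] .
  then show ?thesis using arclength_param_eq[OF fin t] sub by (auto simp: path_image_def)
qed

text \<open>The parametrization is continuous only on its interval and \<open>g\<close> is Borel
  only on \<open>S\<close>; the indicator makes the composition a Borel function on the whole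
  line.\<close>

lemma borel_measurable_along_curve:
  assumes "\<gamma> \<in> rectifiable_curves S" "g \<in> borel_measurable (restrict_space borel S)"
  shows "(\<lambda>l. g (arclength_param \<gamma> l) * indicator {0..enn2real (curve_length \<gamma> 0 1)} l :: ennreal)
    \<in> borel_measurable borel"
proof -
  let ?I = "{0..enn2real (curve_length \<gamma> 0 1)}"
  have "continuous_on ?I (arclength_param \<gamma>)"
    using assms(1) lipschitz_on_continuous_on[OF arclength_param_lipschitz]
    by (auto simp: rectifiable_curves_def)
  then have "arclength_param \<gamma> \<in> restrict_space borel ?I \<rightarrow>\<^sub>M restrict_space borel S"
    using arclength_param_in[OF assms(1)]
    by (intro measurable_restrict_space2 borel_measurable_continuous_on_restrict) (auto simp: space_restrict_space)
  then have "(\<lambda>l. g (arclength_param \<gamma> l)) \<in> borel_measurable (restrict_space borel ?I)"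
    using assms(2) by (rule measurable_compose)
  then show ?thesis
    by (subst (asm) borel_measurable_restrict_space_iff_ennreal) auto
qed

text \<open>This makes the upper gradient inequality available on every subinterval of arc lengths:
  the integral over that interval is again the line integral of a curve in \<open>S\<close>. The
  strict inequality \<open>a < b\<close> keeps this curve nonconstant.\<close>

lemma subcurve:
  assumes \<gamma>: "\<gamma> \<in> rectifiable_curves S" and ab: "0 \<le> a" "a < b" "b \<le> enn2real (curve_length \<gamma> 0 1)"
  obtains \<sigma> where "\<sigma> \<in> rectifiable_curves S" "\<sigma> 0 = arclength_param \<gamma> a" "\<sigma> 1 = arclength_param \<gamma> b"
    "\<And>g. g \<in> borel_measurable (restrict_space borel S) \<Longrightarrow>
       line_integral \<sigma> g = (\<integral>\<^sup>+l\<in>{a..b}. g (arclength_param \<gamma> l) \<partial>lborel)"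
proof -
  have fin: "curve_length \<gamma> 0 1 < \<infinity>" and pth: "path \<gamma>" and sub: "path_image \<gamma> \<subseteq> S"
    using assms by (auto simp: rectifiable_curves_def)
  obtain s where s: "s \<in> {0..1}" "curve_length \<gamma> 0 s = ennreal a"
    using curve_length_surj[OF pth fin, of a] ab by auto
  obtain t where t: "t \<in> {0..1}" "curve_length \<gamma> 0 t = ennreal b"
    using curve_length_surj[OF pth fin, of b] ab by auto
  have "s < t"
  proof (rule ccontr)
    assume "\<not> s < t"
    then have "curve_length \<gamma> 0 s = curve_length \<gamma> 0 t + curve_length \<gamma> t s"
      using s t by (intro curve_length_add) auto
    then have "ennreal b \<le> ennreal a" using s t by simp
    then show False using ab by auto
  qed
  define k where "k = t - s"
  have k: "0 < k" using \<open>s < t\<close> by (simp add: k_def)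
  define \<sigma> where "\<sigma> x = \<gamma> (s + k * x)" for x
  have in01: "s + k * x \<in> {0..1}" if "x \<in> {0..1}" for x
  proof -
    have "k * x \<le> k * 1" using k that by (intro mult_left_mono) auto
    moreover have "0 \<le> k * x" using k that by simp
    moreover have "s + k = t" by (simp add: k_def)
    ultimately show ?thesis using s t by auto
  qed
  have len: "curve_length \<sigma> x y = curve_length \<gamma> (s + k * x) (s + k * y)" for x y
    unfolding \<sigma>_def by (rule curve_length_affine[OF k])
  \<comment> \<open>Lengths along \<open>\<sigma>\<close> are lengths along \<open>\<gamma>\<close>
    diminished by \<open>a\<close>, so the arc length parametrization of \<open>\<sigma>\<close> is
    that of \<open>\<gamma>\<close> translated by \<open>a\<close>.\<close>
  have len0: "curve_length \<gamma> 0 (s + k * x) = ennreal a + curve_length \<sigma> 0 x" if "0 \<le> x" for x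
    using curve_length_add[of 0 s "s + k * x" \<gamma>] s that k by (simp add: len)
  have "ennreal b = ennreal a + curve_length \<sigma> 0 1"
    using len0[of 1] t by (simp add: k_def)
  also have "ennreal b = ennreal a + ennreal (b - a)" using ab by (simp flip: ennreal_plus)
  finally have len1: "curve_length \<sigma> 0 1 = ennreal (b - a)"
    by (simp add: ennreal_add_left_cancel)
  have ends: "\<sigma> 0 = arclength_param \<gamma> a" "\<sigma> 1 = arclength_param \<gamma> b"
    using arclength_param_eq[OF fin s] arclength_param_eq[OF fin t] by (simp_all add: \<sigma>_def k_def)
  have rect: "\<sigma> \<in> rectifiable_curves S"
    unfolding rectifiable_curves_def
  proof (safe)
    show pths: "path \<sigma>"
      unfolding path_def \<sigma>_def
    proof (rule continuous_on_compose2[of "{0..1}" \<gamma>])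
      show "continuous_on {0..1} \<gamma>" using pth by (simp add: path_def)
      show "continuous_on {0..1} (\<lambda>x. s + k * x)" by (intro continuous_intros)
      show "(\<lambda>x. s + k * x) ` {0..1} \<subseteq> {0..1}" using in01 by auto
    qed
    show "x \<in> S" if "x \<in> path_image \<sigma>" for x
      using that in01 sub by (auto simp: path_image_def \<sigma>_def)
    show "curve_length \<sigma> 0 1 < \<infinity>" by (simp add: len1)
    assume "\<sigma> constant_on {0..1}"
    then obtain c where c: "\<And>x. x \<in> {0..1} \<Longrightarrow> \<sigma> x = c" by (auto simp: constant_on_def)
    have "curve_length \<sigma> 0 1 \<le> 0"
    proof (rule curve_length_leI)
      fix n and t :: "nat \<Rightarrow> real" assume "\<And>i. i \<le> n \<Longrightarrow> t i \<in> {0..1}"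
      then have "\<sigma> (t i) = c" if "i \<le> n" for i using that c by blast
      then show "(\<Sum>i<n. ennreal (dist (\<sigma> (t i)) (\<sigma> (t (Suc i))))) \<le> 0" by simp
    qed
    then show False using len1 ab by simp
  qed
  have param: "arclength_param \<sigma> l = arclength_param \<gamma> (a + l)" if l: "l \<in> {0..b - a}" for l
  proof -
    obtain x where x: "x \<in> {0..1}" "curve_length \<sigma> 0 x = ennreal l"
      using curve_length_surj[of \<sigma> l] rect l ab by (auto simp: rectifiable_curves_def len1)
    have "curve_length \<gamma> 0 (s + k * x) = ennreal (a + l)"
      using len0[of x] x l ab by simp
    then have "arclength_param \<gamma> (a + l) = \<gamma> (s + k * x)"
      using in01[OF x(1)] by (intro arclength_param_eq[OF fin]) auto
    moreover have "arclength_param \<sigma> l = \<sigma> x"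
      using x by (intro arclength_param_eq) (auto simp: len1)
    ultimately show ?thesis by (simp add: \<sigma>_def)
  qed
  have "line_integral \<sigma> g = (\<integral>\<^sup>+l\<in>{a..b}. g (arclength_param \<gamma> l) \<partial>lborel)"
    if g: "g \<in> borel_measurable (restrict_space borel S)" for g
  proof -
    let ?L = "enn2real (curve_length \<gamma> 0 1)"
    \<comment> \<open>Measurability is known only after cutting off to the full parameter interval;
      a second indicator restricts it to \<open>{a..b}\<close>.\<close>
    have "(\<lambda>l. (g (arclength_param \<gamma> l) * indicator {0..?L} l) * indicator {a..b} l) \<in> borel_measurable borel"
      using borel_measurable_along_curve[OF \<gamma> g] by measurable
    moreover have "(\<lambda>l. (g (arclength_param \<gamma> l) * indicator {0..?L} l) * indicator {a..b} l)
      = (\<lambda>l. g (arclength_param \<gamma> l) * indicator {a..b} l)"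
      using ab by (auto simp: fun_eq_iff indicator_def)
    ultimately have m: "(\<lambda>l. g (arclength_param \<gamma> l) * indicator {a..b} l) \<in> borel_measurable borel"
      by simp
    have "(\<integral>\<^sup>+l\<in>{a..b}. g (arclength_param \<gamma> l) \<partial>lborel)
        = (\<integral>\<^sup>+l. g (arclength_param \<gamma> (a + l)) * indicator {a..b} (a + l) \<partial>lborel)"
      using nn_integral_real_affine[OF m, of 1 a] by simp
    also have "\<dots> = line_integral \<sigma> g"
      unfolding line_integral_def len1 using ab
      by (intro nn_integral_cong) (auto simp: indicator_def param)
    finally show ?thesis by simp
  qed
  then show thesis using that rect ends by blast
qed

section \<open>Two bounds on increments\<close>

text \<open>This avoids differentiating the absolutely continuous function \<open>\<phi>\<close>: the set \<open>E\<close> on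
  which the first bound is used, with the second one used off \<open>E\<close>, is taken to be a finite union of
  intervals, then an open set, and finally, by outer regularity, \<open>{x. G x \<le> H x}\<close>. Half-open
  intervals make the splitting of \<open>{a<..b}\<close> disjoint even when the measures have atoms.\<close>

lemma increment_le_split_finite_Union:
  fixes \<phi> :: "real \<Rightarrow> real" and M N :: "real measure"
  assumes sets: "sets M = sets borel" "sets N = sets borel"
    and M: "\<And>a b. A \<le> a \<Longrightarrow> a \<le> b \<Longrightarrow> b \<le> B \<Longrightarrow> ennreal \<bar>\<phi> b - \<phi> a\<bar> \<le> emeasure M {a<..b}"
    and N: "\<And>a b. A \<le> a \<Longrightarrow> a \<le> b \<Longrightarrow> b \<le> B \<Longrightarrow> ennreal \<bar>\<phi> b - \<phi> a\<bar> \<le> emeasure N {a<..b}"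
    and "finite I" and ab: "A \<le> a" "a \<le> b" "b \<le> B"
  shows "ennreal \<bar>\<phi> b - \<phi> a\<bar> \<le> emeasure M ({a<..b} \<inter> (\<Union>i\<in>I. {c i<..d i}))
    + emeasure N ({a<..b} - (\<Union>i\<in>I. {c i<..d i}))"
  using \<open>finite I\<close> ab
proof (induction I arbitrary: a b)
  case empty
  then show ?case using N by simp
next
  case (insert i I)
  let ?U = "\<Union>j\<in>I. {c j<..d j}" and ?V = "\<Union>j\<in>insert i I. {c j<..d j}"
  \<comment> \<open>The end points of the new interval are clamped to \<open>{a..b}\<close>. Then
    \<open>{x<..y}\<close> lies inside \<open>{c i<..d i}\<close> while \<open>{a<..x}\<close> and
    \<open>{y<..b}\<close> avoid it, so the induction hypothesis applies to these two outer pieces.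
    If the two intervals do not meet, then \<open>x = y\<close>.\<close>
  define x where "x = max a (min b (c i))"
  define y where "y = max x (min b (d i))"
  have xy: "a \<le> x" "x \<le> y" "y \<le> b" using insert.prems by (auto simp: x_def y_def)
  have sb: "X \<in> sets M" "X \<in> sets N" if "X \<in> sets borel" for X using sets that by auto
  have *: "ennreal \<bar>\<phi> t - \<phi> s\<bar> \<le> emeasure M ({s<..t} \<inter> ?V) + emeasure N ({s<..t} - ?V)"
    if st: "a \<le> s" "s \<le> t" "t \<le> b" and "{s<..t} \<inter> {c i<..d i} = {}" for s t
  proof -
    have "{s<..t} \<inter> ?V = {s<..t} \<inter> ?U" "{s<..t} - ?V = {s<..t} - ?U" using that by auto
    then show ?thesis using insert.IH[of s t] insert.prems st by auto
  qed
  have "ennreal \<bar>\<phi> b - \<phi> a\<bar> \<le> ennreal \<bar>\<phi> x - \<phi> a\<bar> + ennreal \<bar>\<phi> y - \<phi> x\<bar> + ennreal \<bar>\<phi> b - \<phi> y\<bar>"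
    by (simp flip: ennreal_plus)
  also have "\<dots> \<le> (emeasure M ({a<..x} \<inter> ?V) + emeasure N ({a<..x} - ?V)) + emeasure M ({x<..y} \<inter> ?V)
      + (emeasure M ({y<..b} \<inter> ?V) + emeasure N ({y<..b} - ?V))"
  proof (intro add_mono)
    show "ennreal \<bar>\<phi> x - \<phi> a\<bar> \<le> emeasure M ({a<..x} \<inter> ?V) + emeasure N ({a<..x} - ?V)"
      by (rule *) (use xy in \<open>auto simp: x_def\<close>)
    show "ennreal \<bar>\<phi> b - \<phi> y\<bar> \<le> emeasure M ({y<..b} \<inter> ?V) + emeasure N ({y<..b} - ?V)"
      by (rule *) (use xy in \<open>auto simp: x_def y_def\<close>)
    have "{x<..y} \<inter> ?V = {x<..y}" by (auto simp: x_def y_def)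
    then show "ennreal \<bar>\<phi> y - \<phi> x\<bar> \<le> emeasure M ({x<..y} \<inter> ?V)"
      using M[of x y] xy insert.prems by auto
  qed
  also have "\<dots> = (emeasure M ({a<..x} \<inter> ?V) + emeasure M ({x<..y} \<inter> ?V) + emeasure M ({y<..b} \<inter> ?V))
      + (emeasure N ({a<..x} - ?V) + emeasure N ({y<..b} - ?V))"
    by (simp add: ac_simps)
  also have "\<dots> \<le> emeasure M ({a<..b} \<inter> ?V) + emeasure N ({a<..b} - ?V)"
  proof (rule add_mono)
    have V: "?V \<in> sets borel" by (rule sets.finite_UN) (use insert.hyps in auto)
    have "emeasure M ({a<..x} \<inter> ?V) + emeasure M ({x<..y} \<inter> ?V)
        = emeasure M ({a<..x} \<inter> ?V \<union> {x<..y} \<inter> ?V)"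
      using V xy by (intro plus_emeasure) (auto intro!: sb simp del: UN_insert)
    moreover have "emeasure M ({a<..x} \<inter> ?V \<union> {x<..y} \<inter> ?V) + emeasure M ({y<..b} \<inter> ?V)
        = emeasure M (({a<..x} \<inter> ?V \<union> {x<..y} \<inter> ?V) \<union> {y<..b} \<inter> ?V)"
      using V xy by (intro plus_emeasure) (auto intro!: sb simp del: UN_insert)
    ultimately have "emeasure M ({a<..x} \<inter> ?V) + emeasure M ({x<..y} \<inter> ?V) + emeasure M ({y<..b} \<inter> ?V)
        = emeasure M (({a<..x} \<inter> ?V \<union> {x<..y} \<inter> ?V) \<union> {y<..b} \<inter> ?V)"
      by simp
    also have "({a<..x} \<inter> ?V \<union> {x<..y} \<inter> ?V) \<union> {y<..b} \<inter> ?V = {a<..b} \<inter> ?V"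
      using xy by auto
    finally show "emeasure M ({a<..x} \<inter> ?V) + emeasure M ({x<..y} \<inter> ?V) + emeasure M ({y<..b} \<inter> ?V)
        \<le> emeasure M ({a<..b} \<inter> ?V)" by simp
    have "emeasure N ({a<..x} - ?V) + emeasure N ({y<..b} - ?V) = emeasure N (({a<..x} - ?V) \<union> ({y<..b} - ?V))"
      using V xy by (intro plus_emeasure) (auto intro!: sb simp del: UN_insert)
    also have "\<dots> \<le> emeasure N ({a<..b} - ?V)"
      using V xy by (intro emeasure_mono) (auto intro!: sb simp del: UN_insert)
    finally show "emeasure N ({a<..x} - ?V) + emeasure N ({y<..b} - ?V) \<le> emeasure N ({a<..b} - ?V)" .
  qed
  finally show ?case .
qed

lemma open_real_Union_half_open:
  fixes U :: "real set"
  assumes "open U"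
  obtains c d :: "nat \<Rightarrow> real" where "U = (\<Union>i. {c i<..d i})"
proof -
  define D where "D = {(p, q). p \<in> \<rat> \<and> q \<in> \<rat> \<and> {p<..q} \<subseteq> U}"
  have "D \<subseteq> \<rat> \<times> \<rat>" by (auto simp: D_def)
  then have "countable D"
    by (rule countable_subset) (intro countable_SIGMA countable_rat)
  \<comment> \<open>The pair of an empty interval keeps \<open>D\<close> nonempty, so that it can be
    enumerated by the naturals even if \<open>U\<close> is empty.\<close>
  moreover have "(0, 0) \<in> D" by (auto simp: D_def)
  ultimately obtain e :: "nat \<Rightarrow> real \<times> real" where e: "range e = D"
    by (metis empty_iff range_from_nat_into)
  have "U = (\<Union>i. {fst (e i)<..snd (e i)})"
  proof (intro equalityI subsetI)
    fix x assume "x \<in> U"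
    then obtain r where r: "0 < r" "ball x r \<subseteq> U" using assms open_contains_ball by blast
    obtain p where p: "p \<in> \<rat>" "x - r < p" "p < x" using Rats_dense_in_real[of "x - r" x] r by auto
    obtain q where q: "q \<in> \<rat>" "x < q" "q < x + r" using Rats_dense_in_real[of x "x + r"] r by auto
    have "{p<..q} \<subseteq> ball x r" using p q by (auto simp: dist_real_def)
    then have "(p, q) \<in> D" using p q r by (auto simp: D_def)
    then obtain i where "e i = (p, q)" using e by (metis imageE)
    then show "x \<in> (\<Union>i. {fst (e i)<..snd (e i)})" using p q by (intro UN_I[of i]) auto
  next
    fix x assume "x \<in> (\<Union>i. {fst (e i)<..snd (e i)})"
    then obtain i where "x \<in> {fst (e i)<..snd (e i)}" by blast
    moreover have "e i \<in> D" using e by blast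
    ultimately show "x \<in> U" by (auto simp: D_def)
  qed
  then show thesis by (rule that)
qed

text \<open>\<open>U\<close> is exhausted by finite unions of half-open intervals. The first term
  stays below the measure of \<open>U\<close>, and finiteness of \<open>N\<close> gives continuity
  from above for the remainders.\<close>

lemma increment_le_split_open:
  fixes \<phi> :: "real \<Rightarrow> real" and M N :: "real measure"
  assumes sets: "sets M = sets borel" "sets N = sets borel" and "finite_measure N"
    and M: "\<And>a b. A \<le> a \<Longrightarrow> a \<le> b \<Longrightarrow> b \<le> B \<Longrightarrow> ennreal \<bar>\<phi> b - \<phi> a\<bar> \<le> emeasure M {a<..b}"
    and N: "\<And>a b. A \<le> a \<Longrightarrow> a \<le> b \<Longrightarrow> b \<le> B \<Longrightarrow> ennreal \<bar>\<phi> b - \<phi> a\<bar> \<le> emeasure N {a<..b}"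
    and "A \<le> B" "open U"
  shows "ennreal \<bar>\<phi> B - \<phi> A\<bar> \<le> emeasure M U + emeasure N ({A<..B} - U)"
proof -
  interpret N: finite_measure N by fact
  have sb: "X \<in> sets M" "X \<in> sets N" if "X \<in> sets borel" for X using sets that by auto
  obtain c d where U: "U = (\<Union>i :: nat. {c i<..d i :: real})"
    using open_real_Union_half_open[OF \<open>open U\<close>] .
  let ?V = "\<lambda>n. \<Union>i<n. {c i<..d i}"
  have V: "?V n \<in> sets borel" for n by auto
  have "ennreal \<bar>\<phi> B - \<phi> A\<bar> \<le> emeasure M U + emeasure N ({A<..B} - ?V n)" for n
  proof -
    have "ennreal \<bar>\<phi> B - \<phi> A\<bar> \<le> emeasure M ({A<..B} \<inter> ?V n) + emeasure N ({A<..B} - ?V n)"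
      using increment_le_split_finite_Union[OF sets M N finite_lessThan[of n], of A B] \<open>A \<le> B\<close> by simp
    also have "emeasure M ({A<..B} \<inter> ?V n) \<le> emeasure M U"
      using \<open>open U\<close> by (intro emeasure_mono) (auto simp: U intro!: sb)
    finally show ?thesis by (simp add: add_right_mono)
  qed
  \<comment> \<open>Truncated subtraction isolates the only term that depends on \<open>n\<close>,
    so the infimum can be taken there.\<close>
  then have "ennreal \<bar>\<phi> B - \<phi> A\<bar> - emeasure M U \<le> (INF n. emeasure N ({A<..B} - ?V n))"
    by (intro INF_greatest) (simp add: ennreal_minus_le_iff)
  then have "ennreal \<bar>\<phi> B - \<phi> A\<bar> \<le> emeasure M U + (INF n. emeasure N ({A<..B} - ?V n))"
    by (simp add: ennreal_minus_le_iff)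
  also have "(INF n. emeasure N ({A<..B} - ?V n)) = emeasure N (\<Inter>n. {A<..B} - ?V n)"
  proof (rule INF_emeasure_decseq)
    show "range (\<lambda>n. {A<..B} - ?V n) \<subseteq> sets N" using V by (auto intro!: sb)
    show "decseq (\<lambda>n. {A<..B} - ?V n)" by (rule decseq_SucI) auto
  qed simp
  also have "(\<Inter>n. {A<..B} - ?V n) = {A<..B} - U"
    by (auto simp: U)
  finally show ?thesis .
qed

lemma increment_le_integral_min:
  fixes \<phi> :: "real \<Rightarrow> real" and G H :: "real \<Rightarrow> ennreal"
  assumes meas: "G \<in> borel_measurable borel" "H \<in> borel_measurable borel"
    and fin: "(\<integral>\<^sup>+x. G x \<partial>lborel) < \<infinity>" "(\<integral>\<^sup>+x. H x \<partial>lborel) < \<infinity>"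
    and G: "\<And>a b. A \<le> a \<Longrightarrow> a < b \<Longrightarrow> b \<le> B \<Longrightarrow> ennreal \<bar>\<phi> b - \<phi> a\<bar> \<le> (\<integral>\<^sup>+x\<in>{a..b}. G x \<partial>lborel)"
    and H: "\<And>a b. A \<le> a \<Longrightarrow> a < b \<Longrightarrow> b \<le> B \<Longrightarrow> ennreal \<bar>\<phi> b - \<phi> a\<bar> \<le> (\<integral>\<^sup>+x\<in>{a..b}. H x \<partial>lborel)"
    and "A \<le> B"
  shows "ennreal \<bar>\<phi> B - \<phi> A\<bar> \<le> (\<integral>\<^sup>+x. min (G x) (H x) \<partial>lborel)"
proof -
  define M where "M = density lborel G"
  define N where "N = density lborel H"
  have sets: "sets M = sets borel" "sets N = sets borel" by (auto simp: M_def N_def)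
  have em: "emeasure M X = (\<integral>\<^sup>+x\<in>X. G x \<partial>lborel)" "emeasure N X = (\<integral>\<^sup>+x\<in>X. H x \<partial>lborel)"
    if "X \<in> sets borel" for X
    using meas that by (auto simp: M_def N_def emeasure_density)
  have fm: "finite_measure M" "finite_measure N"
    using em[of UNIV] fin by (auto intro!: finite_measureI simp: M_def N_def)
  \<comment> \<open>Single points are Lebesgue null, so the closed intervals of the hypotheses may
    be replaced by half-open ones.\<close>
  have half: "(\<integral>\<^sup>+x\<in>{a..b}. g x \<partial>lborel) = (\<integral>\<^sup>+x\<in>{a<..b}. g x \<partial>lborel)" for a b :: real and g :: "real \<Rightarrow> ennreal"
    by (rule nn_integral_cong_AE) (use AE_lborel_singleton[of a] in eventually_elim, auto simp: indicator_def)
  have MN: "ennreal \<bar>\<phi> b - \<phi> a\<bar> \<le> emeasure M {a<..b}" "ennreal \<bar>\<phi> b - \<phi> a\<bar> \<le> emeasure N {a<..b}"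
    if "A \<le> a" "a \<le> b" "b \<le> B" for a b
    using G[of a b] H[of a b] that by (cases "a = b"; auto simp: em half)+
  \<comment> \<open>Integrating \<open>G\<close> over \<open>E\<close> and \<open>H\<close> over its
    complement gives exactly the integral of the minimum. For open \<open>U\<close> containing
    \<open>E\<close>, the part outside \<open>U\<close> lies in the complement of \<open>E\<close>,
    so only the \<open>M\<close>-measure of \<open>U\<close> remains to be optimized.\<close>
  define E where "E = {x. G x \<le> H x}"
  have E: "E \<in> sets borel" unfolding E_def using meas by measurable
  have "ennreal \<bar>\<phi> B - \<phi> A\<bar> \<le> emeasure M U + emeasure N (- E)" if "E \<subseteq> U" "open U" for U
  proof -
    have "ennreal \<bar>\<phi> B - \<phi> A\<bar> \<le> emeasure M U + emeasure N ({A<..B} - U)"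
      using MN \<open>A \<le> B\<close> \<open>open U\<close> by (intro increment_le_split_open[OF sets fm(2)]) auto
    also have "emeasure N ({A<..B} - U) \<le> emeasure N (- E)"
      using that E by (intro emeasure_mono) (auto simp: sets)
    finally show ?thesis by (simp add: add_left_mono)
  qed
  then have "ennreal \<bar>\<phi> B - \<phi> A\<bar> - emeasure N (- E) \<le> (INF U\<in>{U. E \<subseteq> U \<and> open U}. emeasure M U)"
    by (intro INF_greatest) (auto simp: ennreal_minus_le_iff add.commute)
  then have "ennreal \<bar>\<phi> B - \<phi> A\<bar> \<le> emeasure N (- E) + (INF U\<in>{U. E \<subseteq> U \<and> open U}. emeasure M U)"
    by (simp add: ennreal_minus_le_iff)
  also have "(INF U\<in>{U. E \<subseteq> U \<and> open U}. emeasure M U) = emeasure M E"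
    using fm(1) sets E by (intro outer_regular[symmetric]) (auto simp: finite_measure.emeasure_finite)
  also have "emeasure N (- E) + emeasure M E = (\<integral>\<^sup>+x. H x * indicator (- E) x + G x * indicator E x \<partial>lborel)"
    using E meas by (subst nn_integral_add) (auto simp: em)
  also have "\<dots> = (\<integral>\<^sup>+x. min (G x) (H x) \<partial>lborel)"
    by (rule nn_integral_cong) (auto simp: E_def indicator_def min_def)
  finally show ?thesis .
qed

section \<open>Minimal weak upper gradients\<close>

lemma ennpowr_top [simp]: "ennpowr top p = top"
  by (simp add: ennpowr_def)

lemma ennpowr_ennreal [simp]: "0 \<le> x \<Longrightarrow> ennpowr (ennreal x) p = ennreal (x powr p)"
  by (simp add: ennpowr_def)

lemma ennpowr_mono: "0 \<le> p \<Longrightarrow> a \<le> b \<Longrightarrow> ennpowr a p \<le> ennpowr b p"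
  by (cases a; cases b) (auto simp: powr_mono2 top_unique)

lemma ennpowr_finite_iff: "ennpowr a p < top \<longleftrightarrow> a < top"
  by (cases a) auto

lemma ennpowr_root: "0 < p \<Longrightarrow> ennpowr (ennpowr a (1 / p)) p = a"
  by (cases a) (auto simp: powr_powr)

lemma ennpowr_root': "0 < p \<Longrightarrow> ennpowr (ennpowr a p) (1 / p) = a"
  by (cases a) (auto simp: powr_powr)

lemma ennpowr_cmult: "0 < c \<Longrightarrow> ennpowr (ennreal c * a) p = ennreal (c powr p) * ennpowr a p"
  by (cases a) (auto simp: powr_mult ennreal_mult_top simp flip: ennreal_mult)

text \<open>A crude form of the triangle inequality, from a + b being at most twice the maximum; it
  serves only to show that integrals are finite.\<close>

lemma ennpowr_add_le:
  assumes "0 < p"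
  shows "ennpowr (a + b) p \<le> ennreal (2 powr p) * (ennpowr a p + ennpowr b p)"
proof -
  have "a + b \<le> ennreal 2 * max a b"
    by (metis add_mono ennreal_numeral max.cobounded1 max.cobounded2 mult_2)
  then have "ennpowr (a + b) p \<le> ennpowr (ennreal 2 * max a b) p"
    using assms by (intro ennpowr_mono) auto
  also have "\<dots> = ennreal (2 powr p) * ennpowr (max a b) p"
    by (rule ennpowr_cmult) simp
  also have "ennpowr (max a b) p \<le> ennpowr a p + ennpowr b p"
    by (auto simp: max_def)
  finally show ?thesis by (simp add: mult_left_mono)
qed

lemma le_one_add_ennpowr:
  assumes "1 \<le> p"
  shows "a \<le> 1 + ennpowr a p"
proof (cases "a \<le> 1")
  case True
  then show ?thesis by (simp add: add_increasing2)
next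
  case False
  have "a \<le> ennpowr a p"
  proof (cases a)
    case (real x)
    then have "1 < x" using False by (simp add: ennreal_less_one_iff not_le flip: ennreal_1)
    then have "x powr 1 \<le> x powr p" using assms by (intro powr_mono) auto
    then show ?thesis using real by simp
  qed simp
  then show ?thesis by (simp add: add_increasing)
qed

text \<open>Each power lies below the sum and roots are monotone. Combining countably many weights
  by a supremum instead of a series thus bounds the integral of the p-th power by a sum, without the
  triangle inequality in \<open>L\<^sup>p\<close>.\<close>

lemma ennpowr_SUP_le:
  fixes a :: "nat \<Rightarrow> ennreal"
  assumes "0 < p"
  shows "ennpowr (SUP n. a n) p \<le> (\<Sum>n. ennpowr (a n) p)"
proof -
  let ?s = "\<Sum>n. ennpowr (a n) p"
  have "a n \<le> ennpowr ?s (1 / p)" for n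
  proof -
    have "ennpowr (a n) p \<le> ?s"
      using sum_le_suminf[of "\<lambda>n. ennpowr (a n) p" "{n}"] by simp
    then have "ennpowr (ennpowr (a n) p) (1 / p) \<le> ennpowr ?s (1 / p)"
      using assms by (intro ennpowr_mono) auto
    then show ?thesis using assms by (simp add: ennpowr_root')
  qed
  then have "ennpowr (SUP n. a n) p \<le> ennpowr (ennpowr ?s (1 / p)) p"
    using assms by (intro ennpowr_mono SUP_least) auto
  then show ?thesis using assms by (simp add: ennpowr_root)
qed

lemma borel_measurable_ennpowr [measurable]:
  assumes [measurable]: "f \<in> borel_measurable M"
  shows "(\<lambda>x. ennpowr (f x) p) \<in> borel_measurable M"
  unfolding ennpowr_def by measurable

lemma Lp_norm_finite_iff:
  "Lp_norm M (ereal p) h < top \<longleftrightarrow> (\<integral>\<^sup>+x. ennpowr (h x) p \<partial>M) < top"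
  by (simp add: Lp_norm_def ennpowr_finite_iff)

lemma nn_integral_ennpowr_SUP_le:
  fixes f :: "nat \<Rightarrow> 'a \<Rightarrow> ennreal"
  assumes "0 < p" and [measurable]: "\<And>n. f n \<in> borel_measurable M"
  shows "(\<integral>\<^sup>+x. ennpowr (SUP n. f n x) p \<partial>M) \<le> (\<Sum>n. \<integral>\<^sup>+x. ennpowr (f n x) p \<partial>M)"
proof -
  have "(\<integral>\<^sup>+x. ennpowr (SUP n. f n x) p \<partial>M) \<le> (\<integral>\<^sup>+x. (\<Sum>n. ennpowr (f n x) p) \<partial>M)"
    using assms(1) by (intro nn_integral_mono ennpowr_SUP_le)
  also have "\<dots> = (\<Sum>n. \<integral>\<^sup>+x. ennpowr (f n x) p \<partial>M)"
    by (rule nn_integral_suminf) measurable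
  finally show ?thesis .
qed

text \<open>The nonnegative difference has integral zero. This rigidity yields both the minimality
  of the constructed gradient and equality in the convexity inequality.\<close>

lemma AE_eq_of_nn_integral_le:
  fixes f g :: "'a \<Rightarrow> ennreal"
  assumes [measurable]: "f \<in> borel_measurable M" "g \<in> borel_measurable M"
    and "AE x in M. f x \<le> g x" "(\<integral>\<^sup>+x. g x \<partial>M) \<le> (\<integral>\<^sup>+x. f x \<partial>M)" "(\<integral>\<^sup>+x. f x \<partial>M) < \<infinity>"
  shows "AE x in M. f x = g x"
proof -
  have "(\<integral>\<^sup>+x. g x - f x \<partial>M) = (\<integral>\<^sup>+x. g x \<partial>M) - (\<integral>\<^sup>+x. f x \<partial>M)"
    using assms by (intro nn_integral_diff) auto
  also have "\<dots> = 0" using assms by (simp add: diff_eq_0_iff_ennreal le_less_trans)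
  finally have "AE x in M. g x - f x = 0"
    by (subst (asm) nn_integral_0_iff_AE) auto
  moreover have "AE x in M. f x \<noteq> \<infinity>"
    using assms(5) by (intro nn_integral_PInf_AE) auto
  ultimately show ?thesis
    using assms(3) by eventually_elim (auto simp: diff_eq_0_iff_ennreal intro: antisym)
qed

section \<open>Borel functions on the carrier and their line integrals\<close>

lemma measurable_measure_on:
  assumes "sets \<mu> = sets borel" "g \<in> borel_measurable (restrict_space borel S)"
  shows "g \<in> borel_measurable (measure_on \<mu> S)"
proof (rule measurableI)
  have sp: "space \<mu> = UNIV" using sets_eq_imp_space_eq[OF assms(1)] by simp
  fix A :: "'b set" assume "A \<in> sets borel"
  then have "g -` A \<inter> S \<in> sets (restrict_space borel S)"
    using measurable_sets[OF assms(2)] by (auto simp: space_restrict_space)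
  then show "g -` A \<inter> space (measure_on \<mu> S) \<in> sets (measure_on \<mu> S)"
    using assms(1) by (auto simp: measure_on_def space_restrict_space sets_restrict_space sp)
qed simp

lemma line_integral_cmult:
  assumes "\<gamma> \<in> rectifiable_curves S" "g \<in> borel_measurable (restrict_space borel S)"
  shows "line_integral \<gamma> (\<lambda>x. c * g x) = c * line_integral \<gamma> g"
  unfolding line_integral_def
  using nn_integral_cmult[of _ lborel c] borel_measurable_along_curve[OF assms] by (simp add: mult.assoc)

lemma line_integral_add:
  assumes "\<gamma> \<in> rectifiable_curves S" "g \<in> borel_measurable (restrict_space borel S)"
    "h \<in> borel_measurable (restrict_space borel S)"
  shows "line_integral \<gamma> (\<lambda>x. g x + h x) = line_integral \<gamma> g + line_integral \<gamma> h"
  unfolding line_integral_def distrib_right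
  using borel_measurable_along_curve[OF assms(1,2)] borel_measurable_along_curve[OF assms(1,3)]
  by (subst nn_integral_add) auto

lemma line_integral_mono:
  "(\<And>x. g x \<le> h x) \<Longrightarrow> line_integral \<gamma> g \<le> line_integral \<gamma> h"
  unfolding line_integral_def by (intro nn_integral_mono mult_right_mono) auto

lemma line_integral_INF:
  fixes g :: "nat \<Rightarrow> 'a :: metric_space \<Rightarrow> ennreal"
  assumes "\<gamma> \<in> rectifiable_curves S" "\<And>n. g n \<in> borel_measurable (restrict_space borel S)"
    and "\<And>n x. g (Suc n) x \<le> g n x" "line_integral \<gamma> (g 0) < \<infinity>"
  shows "line_integral \<gamma> (\<lambda>x. INF n. g n x) = (INF n. line_integral \<gamma> (g n))"
proof -
  let ?f = "\<lambda>n l. g n (arclength_param \<gamma> l) * indicator {0..enn2real (curve_length \<gamma> 0 1)} l"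
  have "line_integral \<gamma> (\<lambda>x. INF n. g n x) = (\<integral>\<^sup>+l. (INF n. ?f n l) \<partial>lborel)"
    unfolding line_integral_def by (intro nn_integral_cong) (auto simp: indicator_def)
  also have "\<dots> = (INF n. line_integral \<gamma> (g n))"
    unfolding line_integral_def
    using assms borel_measurable_along_curve[OF assms(1,2)]
    by (intro nn_integral_monotone_convergence_INF_AE[where i = 0])
       (auto simp: line_integral_def intro!: mult_right_mono)
  finally show ?thesis .
qed

text \<open>A curve family has modulus zero iff some weight in \<open>L\<^sup>p\<close> has infinite line integral along each of
  its curves. Unlike the family, the weight controls subcurves as well.\<close>

lemma weak_upper_gradientI:
  assumes "sets \<mu> = sets borel" "0 < p" "g \<in> borel_measurable (restrict_space borel S)"
    and \<rho>: "\<rho> \<in> borel_measurable (restrict_space borel S)" "(\<integral>\<^sup>+x. ennpowr (\<rho> x) p \<partial>measure_on \<mu> S) < \<infinity>"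
    and ug: "\<And>\<gamma>. \<gamma> \<in> rectifiable_curves S \<Longrightarrow> line_integral \<gamma> \<rho> < \<infinity> \<Longrightarrow> ug_inequality u g \<gamma>"
  shows "weak_upper_gradient S \<mu> p u g"
  unfolding weak_upper_gradient_def
proof (intro conjI exI)
  let ?\<Gamma> = "{\<gamma> \<in> rectifiable_curves S. line_integral \<gamma> \<rho> = \<infinity>}"
  let ?I = "\<integral>\<^sup>+x. ennpowr (\<rho> x) p \<partial>measure_on \<mu> S"
  \<comment> \<open>An infinite line integral stays infinite after multiplication by any c > 0, so
    every positive multiple of the weight is admissible for \<open>?\<Gamma>\<close>, at a cost that
    tends to 0 with c.\<close>
  have le: "modulus S \<mu> p ?\<Gamma> \<le> ennreal (c powr p) * ?I" if "0 < c" for c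
  proof -
    have "modulus S \<mu> p ?\<Gamma> \<le> (\<integral>\<^sup>+x. ennpowr (ennreal c * \<rho> x) p \<partial>measure_on \<mu> S)"
      unfolding modulus_def
    proof (rule INF_lower, safe)
      show "(\<lambda>x. ennreal c * \<rho> x) \<in> borel_measurable (restrict_space borel S)" using \<rho>(1) by measurable
      show "1 \<le> line_integral \<gamma> (\<lambda>x. ennreal c * \<rho> x)"
        if "\<gamma> \<in> rectifiable_curves S" "line_integral \<gamma> \<rho> = \<infinity>" for \<gamma>
        using that \<open>0 < c\<close> by (simp add: line_integral_cmult[OF _ \<rho>(1)] ennreal_mult_top)
    qed
    also have "\<dots> = ennreal (c powr p) * ?I"
      using measurable_measure_on[OF assms(1) \<rho>(1)] that
      by (simp add: ennpowr_cmult nn_integral_cmult)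
    finally show ?thesis .
  qed
  obtain i where i: "?I = ennreal i" "0 \<le> i" using \<rho>(2) by (cases ?I) auto
  have "modulus S \<mu> p ?\<Gamma> \<le> 0 + ennreal e" if "0 < e" for e
  proof -
    \<comment> \<open>Chosen so that the cost of the scaled weight is at most \<open>e\<close>; the
      summand 1 avoids division by zero.\<close>
    define c where "c = (e / (1 + i)) powr (1 / p)"
    have "0 < c" and cp: "c powr p = e / (1 + i)" using that i assms by (auto simp: c_def powr_powr)
    have "c powr p * i \<le> e" using that i by (simp add: cp field_simps)
    then show ?thesis using le[OF \<open>0 < c\<close>] i
      by (simp add: order_trans ennreal_leI flip: ennreal_mult)
  qed
  then have "modulus S \<mu> p ?\<Gamma> \<le> 0" using ennreal_le_epsilon[of 0] by blast
  then show "modulus S \<mu> p ?\<Gamma> = 0" by simp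
  show "\<forall>\<gamma>\<in>rectifiable_curves S - ?\<Gamma>. ug_inequality u g \<gamma>"
    using ug by (metis (mono_tags, lifting) DiffE infinity_ennreal_def mem_Collect_eq top.not_eq_extremum)
qed (use assms in auto)

lemma weak_upper_gradientE:
  assumes "sets \<mu> = sets borel" "0 < p" "weak_upper_gradient S \<mu> p u g"
  obtains \<rho> where "\<rho> \<in> borel_measurable (restrict_space borel S)"
    "(\<integral>\<^sup>+x. ennpowr (\<rho> x) p \<partial>measure_on \<mu> S) < \<infinity>"
    "\<And>\<gamma>. \<gamma> \<in> rectifiable_curves S \<Longrightarrow> line_integral \<gamma> \<rho> < \<infinity> \<Longrightarrow> ug_inequality u g \<gamma>"
proof -
  obtain \<Gamma> where \<Gamma>: "\<Gamma> \<subseteq> rectifiable_curves S" "modulus S \<mu> p \<Gamma> = 0"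
    "\<And>\<gamma>. \<gamma> \<in> rectifiable_curves S \<Longrightarrow> \<gamma> \<notin> \<Gamma> \<Longrightarrow> ug_inequality u g \<gamma>"
    using assms(3) by (auto simp: weak_upper_gradient_def)
  \<comment> \<open>With this bound the function \<open>\<rho> n\<close> multiplied by n + 1 has
    energy below (1/2)^n. The supremum of these multiples thus has finite energy, but its line
    integral along a curve of \<open>\<Gamma>\<close> is at least n + 1 for every n.\<close>
  define e where "e n = (1/2) ^ n / real (Suc n) powr p" for n
  have "\<exists>\<rho>. \<rho> \<in> borel_measurable (restrict_space borel S) \<and> (\<forall>\<gamma>\<in>\<Gamma>. 1 \<le> line_integral \<gamma> \<rho>) \<and>
      (\<integral>\<^sup>+x. ennpowr (\<rho> x) p \<partial>measure_on \<mu> S) < ennreal (e n)" for n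
  proof -
    have "modulus S \<mu> p \<Gamma> < ennreal (e n)" by (simp add: \<Gamma> e_def)
    then show ?thesis unfolding modulus_def INF_less_iff by auto
  qed
  then obtain \<rho> where \<rho>: "\<And>n. \<rho> n \<in> borel_measurable (restrict_space borel S)"
    "\<And>n \<gamma>. \<gamma> \<in> \<Gamma> \<Longrightarrow> 1 \<le> line_integral \<gamma> (\<rho> n)"
    "\<And>n. (\<integral>\<^sup>+x. ennpowr (\<rho> n x) p \<partial>measure_on \<mu> S) < ennreal (e n)"
    by metis
  define r where "r x = (SUP n. ennreal (real (Suc n)) * \<rho> n x)" for x
  show thesis
  proof (rule that)
    show "r \<in> borel_measurable (restrict_space borel S)"
      unfolding r_def using \<rho>(1) by measurable
    note m = measurable_measure_on[OF assms(1) \<rho>(1)]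
    have "(\<integral>\<^sup>+x. ennpowr (r x) p \<partial>measure_on \<mu> S)
        \<le> (\<Sum>n. \<integral>\<^sup>+x. ennpowr (ennreal (real (Suc n)) * \<rho> n x) p \<partial>measure_on \<mu> S)"
      unfolding r_def using assms(2) m by (intro nn_integral_ennpowr_SUP_le) measurable
    also have "\<dots> \<le> (\<Sum>n. ennreal ((1/2) ^ n))"
    proof (rule suminf_le)
      fix n
      have "(\<integral>\<^sup>+x. ennpowr (ennreal (real (Suc n)) * \<rho> n x) p \<partial>measure_on \<mu> S)
          = ennreal (real (Suc n) powr p) * (\<integral>\<^sup>+x. ennpowr (\<rho> n x) p \<partial>measure_on \<mu> S)"
        using m by (subst ennpowr_cmult) (auto simp: nn_integral_cmult)
      also have "\<dots> \<le> ennreal (real (Suc n) powr p) * ennreal (e n)"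
        using \<rho>(3)[of n] by (intro mult_left_mono) auto
      also have "\<dots> = ennreal ((1/2) ^ n)"
        by (simp add: e_def flip: ennreal_mult)
      finally show "(\<integral>\<^sup>+x. ennpowr (ennreal (real (Suc n)) * \<rho> n x) p \<partial>measure_on \<mu> S) \<le> ennreal ((1/2) ^ n)" .
    qed auto
    also have "\<dots> < \<infinity>"
      by (subst suminf_ennreal2) auto
    finally show "(\<integral>\<^sup>+x. ennpowr (r x) p \<partial>measure_on \<mu> S) < \<infinity>" .
    fix \<gamma> assume \<gamma>: "\<gamma> \<in> rectifiable_curves S" "line_integral \<gamma> r < \<infinity>"
    have "\<gamma> \<notin> \<Gamma>"
    proof
      assume "\<gamma> \<in> \<Gamma>"
      have "ennreal (real (Suc n)) \<le> line_integral \<gamma> r" for n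
      proof -
        have "ennreal (real (Suc n)) * 1 \<le> ennreal (real (Suc n)) * line_integral \<gamma> (\<rho> n)"
          using \<rho>(2)[OF \<open>\<gamma> \<in> \<Gamma>\<close>] by (intro mult_left_mono) auto
        also have "\<dots> = line_integral \<gamma> (\<lambda>x. ennreal (real (Suc n)) * \<rho> n x)"
          by (rule line_integral_cmult[OF \<gamma>(1) \<rho>(1), symmetric])
        also have "\<dots> \<le> line_integral \<gamma> r"
          unfolding r_def by (intro line_integral_mono SUP_upper) auto
        finally show ?thesis by simp
      qed
      note le = this
      obtain i where i: "line_integral \<gamma> r = ennreal i" "0 \<le> i"
        using \<gamma>(2) by (cases "line_integral \<gamma> r") auto
      obtain n where "i < real n" using reals_Archimedean2 by blast
      moreover have "real (Suc n) \<le> i" using le[of n] i by (simp only: ennreal_le_iff)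
      ultimately show False by simp
    qed
    then show "ug_inequality u g \<gamma>" using \<Gamma> \<gamma> by blast
  qed
qed

text \<open>The weights are scaled until their energies are summable, and the supremum is taken. It
  dominates a positive multiple of each of them, so its integrability along a curve forces theirs.
  Countably many exceptional families are thereby excluded at once.\<close>

lemma common_exceptional_weight:
  assumes "sets \<mu> = sets borel" "0 < p"
    and \<rho>: "\<And>n. \<rho> n \<in> borel_measurable (restrict_space borel S)"
      "\<And>n :: nat. (\<integral>\<^sup>+x. ennpowr (\<rho> n x) p \<partial>measure_on \<mu> S) < \<infinity>"
  obtains r where "r \<in> borel_measurable (restrict_space borel S)"
    "(\<integral>\<^sup>+x. ennpowr (r x) p \<partial>measure_on \<mu> S) < \<infinity>"
    "\<And>\<gamma> n. \<gamma> \<in> rectifiable_curves S \<Longrightarrow> line_integral \<gamma> r < \<infinity> \<Longrightarrow> line_integral \<gamma> (\<rho> n) < \<infinity>"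
proof -
  define I where "I n = enn2real (\<integral>\<^sup>+x. ennpowr (\<rho> n x) p \<partial>measure_on \<mu> S)" for n
  have I: "(\<integral>\<^sup>+x. ennpowr (\<rho> n x) p \<partial>measure_on \<mu> S) = ennreal (I n)" "0 \<le> I n" for n
    using \<rho>(2)[of n] by (auto simp: I_def)
  \<comment> \<open>The p-th power of \<open>c n\<close> brings the n-th energy below (1/2)^n;
    adding 1 to \<open>I n\<close> covers an energy equal to zero.\<close>
  define c where "c n = ((1/2) ^ n / (1 + I n)) powr (1 / p)" for n
  have c: "0 < c n" "c n powr p = (1/2) ^ n / (1 + I n)" for n
    using assms(2) I(2)[of n] by (auto simp: c_def powr_powr add_nonneg_eq_0_iff)
  define r where "r x = (SUP n. ennreal (c n) * \<rho> n x)" for x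
  note m = measurable_measure_on[OF assms(1) \<rho>(1)]
  show thesis
  proof (rule that)
    show "r \<in> borel_measurable (restrict_space borel S)"
      unfolding r_def using \<rho>(1) by measurable
    have "(\<integral>\<^sup>+x. ennpowr (r x) p \<partial>measure_on \<mu> S)
        \<le> (\<Sum>n. \<integral>\<^sup>+x. ennpowr (ennreal (c n) * \<rho> n x) p \<partial>measure_on \<mu> S)"
      unfolding r_def using assms(2) m by (intro nn_integral_ennpowr_SUP_le) measurable
    also have "\<dots> \<le> (\<Sum>n. ennreal ((1/2) ^ n))"
    proof (rule suminf_le)
      fix n
      have "(\<integral>\<^sup>+x. ennpowr (ennreal (c n) * \<rho> n x) p \<partial>measure_on \<mu> S)
          = ennreal (c n powr p) * (\<integral>\<^sup>+x. ennpowr (\<rho> n x) p \<partial>measure_on \<mu> S)"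
        using m c by (subst ennpowr_cmult) (auto simp: nn_integral_cmult)
      also have "\<dots> = ennreal (c n powr p * I n)"
        using I(2)[of n] by (simp add: I(1) ennreal_mult)
      also have "\<dots> \<le> ennreal ((1/2) ^ n)"
      proof (rule ennreal_leI)
        have "(1/2) ^ n * (I n / (1 + I n)) \<le> (1/2) ^ n * 1"
          using I(2)[of n] by (intro mult_left_mono) auto
        then show "c n powr p * I n \<le> (1/2) ^ n" by (simp add: c)
      qed
      finally show "(\<integral>\<^sup>+x. ennpowr (ennreal (c n) * \<rho> n x) p \<partial>measure_on \<mu> S) \<le> ennreal ((1/2) ^ n)" .
    qed auto
    also have "\<dots> < \<infinity>"
      by (subst suminf_ennreal2) auto
    finally show "(\<integral>\<^sup>+x. ennpowr (r x) p \<partial>measure_on \<mu> S) < \<infinity>" .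
    fix \<gamma> n assume \<gamma>: "\<gamma> \<in> rectifiable_curves S" "line_integral \<gamma> r < \<infinity>"
    have "ennreal (c n) * line_integral \<gamma> (\<rho> n) = line_integral \<gamma> (\<lambda>x. ennreal (c n) * \<rho> n x)"
      by (rule line_integral_cmult[OF \<gamma>(1) \<rho>(1), symmetric])
    also have "\<dots> \<le> line_integral \<gamma> r"
      unfolding r_def by (intro line_integral_mono SUP_upper) auto
    finally have "ennreal (c n) * line_integral \<gamma> (\<rho> n) < \<infinity>" using \<gamma>(2) by simp
    then show "line_integral \<gamma> (\<rho> n) < \<infinity>"
      using c(1)[of n] by (auto simp: ennreal_mult_less_top)
  qed
qed

text \<open>The assumption \<open>sub\<close> is the form in which weights transmit the inequality
  to subcurves. Finite line integrals force \<open>u\<close> to be finite at the ends of each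
  subcurve, hence everywhere on the curve, so \<open>u\<close> along arc length is a real function
  with two bounds on its increments.\<close>

lemma ug_inequality_min:
  assumes \<gamma>: "\<gamma> \<in> rectifiable_curves S"
    and meas: "g \<in> borel_measurable (restrict_space borel S)" "h \<in> borel_measurable (restrict_space borel S)"
    and fin: "line_integral \<gamma> g < \<infinity>" "line_integral \<gamma> h < \<infinity>"
    and sub: "\<And>\<sigma>. \<sigma> \<in> rectifiable_curves S \<Longrightarrow>
        (\<And>\<rho>. \<rho> \<in> borel_measurable (restrict_space borel S) \<Longrightarrow> line_integral \<sigma> \<rho> \<le> line_integral \<gamma> \<rho>) \<Longrightarrow>
        ug_inequality u g \<sigma> \<and> ug_inequality u h \<sigma>"
  shows "ug_inequality u (\<lambda>x. min (g x) (h x)) \<gamma>"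
proof -
  let ?L = "enn2real (curve_length \<gamma> 0 1)"
  let ?c = "arclength_param \<gamma>"
  have L: "0 < ?L" by (rule rectifiable_curve_length_pos[OF \<gamma>])
  have key: "\<bar>u (?c a)\<bar> \<noteq> \<infinity> \<and> \<bar>u (?c b)\<bar> \<noteq> \<infinity> \<and>
      eabs (u (?c b) - u (?c a)) \<le> (\<integral>\<^sup>+l\<in>{a..b}. g (?c l) \<partial>lborel) \<and>
      eabs (u (?c b) - u (?c a)) \<le> (\<integral>\<^sup>+l\<in>{a..b}. h (?c l) \<partial>lborel)"
    if ab: "0 \<le> a" "a < b" "b \<le> ?L" for a b
  proof -
    obtain \<sigma> where \<sigma>: "\<sigma> \<in> rectifiable_curves S" "\<sigma> 0 = ?c a" "\<sigma> 1 = ?c b"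
      "\<And>g. g \<in> borel_measurable (restrict_space borel S) \<Longrightarrow>
         line_integral \<sigma> g = (\<integral>\<^sup>+l\<in>{a..b}. g (?c l) \<partial>lborel)"
      using subcurve[OF \<gamma> ab] by metis
    have le: "line_integral \<sigma> \<rho> \<le> line_integral \<gamma> \<rho>"
      if "\<rho> \<in> borel_measurable (restrict_space borel S)" for \<rho>
      unfolding \<sigma>(4)[OF that] unfolding line_integral_def
      using ab by (intro nn_integral_mono mult_left_mono) (auto simp: indicator_def)
    have ug: "ug_inequality u g \<sigma>" "ug_inequality u h \<sigma>" using sub[OF \<sigma>(1) le] by auto
    have "line_integral \<sigma> g < \<infinity>" using le[OF meas(1)] fin(1) by (rule le_less_trans)
    then show ?thesis
      using ug \<sigma>(4)[OF meas(1)] \<sigma>(4)[OF meas(2)]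
      by (auto simp: ug_inequality_def \<sigma>(2,3) split: if_splits)
  qed
  \<comment> \<open>Every point of the curve ends a nondegenerate subcurve: the initial point begins
    the full curve, and any other point ends the piece starting at 0.\<close>
  define \<phi> where "\<phi> l = real_of_ereal (u (?c l))" for l
  have \<phi>: "u (?c l) = ereal (\<phi> l)" if "0 \<le> l" "l \<le> ?L" for l
    using key[of l ?L] key[of 0 l] that L by (cases "l = 0") (auto simp: \<phi>_def ereal_real)
  have eabs: "eabs (u (?c b) - u (?c a)) = ennreal \<bar>\<phi> b - \<phi> a\<bar>" if "0 \<le> a" "a < b" "b \<le> ?L" for a b
    using that by (simp add: \<phi> eabs_def)
  let ?i = "\<lambda>g l. g (?c l) * indicator {0..?L} l"
  have restr: "(\<integral>\<^sup>+l\<in>{a..b}. ?i g l \<partial>lborel) = (\<integral>\<^sup>+l\<in>{a..b}. g (?c l) \<partial>lborel)"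
    if "0 \<le> a" "b \<le> ?L" for a b and g :: "'a \<Rightarrow> ennreal"
    using that by (intro nn_integral_cong) (auto simp: indicator_def)
  have "ennreal \<bar>\<phi> ?L - \<phi> 0\<bar> \<le> (\<integral>\<^sup>+l. min (?i g l) (?i h l) \<partial>lborel)"
  proof (rule increment_le_integral_min[where A = 0 and B = ?L and \<phi> = \<phi> and G = "?i g" and H = "?i h"])
    show "?i g \<in> borel_measurable borel" "?i h \<in> borel_measurable borel"
      using borel_measurable_along_curve[OF \<gamma>] meas by auto
    show "(\<integral>\<^sup>+l. ?i g l \<partial>lborel) < \<infinity>" "(\<integral>\<^sup>+l. ?i h l \<partial>lborel) < \<infinity>"
      using fin by (auto simp: line_integral_def)
    show "0 \<le> ?L" by simp
    fix a b assume ab: "0 \<le> a" "a < b" "b \<le> ?L"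
    show "ennreal \<bar>\<phi> b - \<phi> a\<bar> \<le> (\<integral>\<^sup>+l\<in>{a..b}. ?i g l \<partial>lborel)"
      "ennreal \<bar>\<phi> b - \<phi> a\<bar> \<le> (\<integral>\<^sup>+l\<in>{a..b}. ?i h l \<partial>lborel)"
      using key[OF ab] ab unfolding eabs[OF ab] restr[OF ab(1,3)] by auto
  qed
  also have "\<dots> = line_integral \<gamma> (\<lambda>x. min (g x) (h x))"
    unfolding line_integral_def by (intro nn_integral_cong) (auto simp: indicator_def)
  finally show ?thesis
    using eabs[of 0 ?L] \<phi>[of 0] \<phi>[of ?L] L arclength_param_ends[OF \<gamma>]
    by (simp add: ug_inequality_def)
qed

lemma weak_upper_gradient_min:
  assumes "sets \<mu> = sets borel" "0 < p"
    and g: "weak_upper_gradient S \<mu> p u g" "(\<integral>\<^sup>+x. ennpowr (g x) p \<partial>measure_on \<mu> S) < \<infinity>"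
    and h: "weak_upper_gradient S \<mu> p u h" "(\<integral>\<^sup>+x. ennpowr (h x) p \<partial>measure_on \<mu> S) < \<infinity>"
  shows "weak_upper_gradient S \<mu> p u (\<lambda>x. min (g x) (h x))"
proof -
  have meas: "g \<in> borel_measurable (restrict_space borel S)" "h \<in> borel_measurable (restrict_space borel S)"
    using g h by (auto simp: weak_upper_gradient_def)
  obtain \<rho> where \<rho>: "\<rho> \<in> borel_measurable (restrict_space borel S)"
    "(\<integral>\<^sup>+x. ennpowr (\<rho> x) p \<partial>measure_on \<mu> S) < \<infinity>"
    "\<And>\<gamma>. \<gamma> \<in> rectifiable_curves S \<Longrightarrow> line_integral \<gamma> \<rho> < \<infinity> \<Longrightarrow> ug_inequality u g \<gamma>"
    using weak_upper_gradientE[OF assms(1,2) g(1)] by metis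
  obtain \<rho>' where \<rho>': "\<rho>' \<in> borel_measurable (restrict_space borel S)"
    "(\<integral>\<^sup>+x. ennpowr (\<rho>' x) p \<partial>measure_on \<mu> S) < \<infinity>"
    "\<And>\<gamma>. \<gamma> \<in> rectifiable_curves S \<Longrightarrow> line_integral \<gamma> \<rho>' < \<infinity> \<Longrightarrow> ug_inequality u h \<gamma>"
    using weak_upper_gradientE[OF assms(1,2) h(1)] by metis
  \<comment> \<open>The functions \<open>\<rho>\<close> and \<open>\<rho>'\<close> exclude the
    exceptional curves of both gradients; \<open>g\<close> and \<open>h\<close> are included so that
    their line integrals are finite. Finiteness for the first two passes to subcurves, whose line
    integrals are no larger.\<close>
  define R where "R n = (if n = 0 then g else if n = 1 then h else if n = 2 then \<rho> else \<rho>')" for n :: nat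
  have R: "R n \<in> borel_measurable (restrict_space borel S)"
    "(\<integral>\<^sup>+x. ennpowr (R n x) p \<partial>measure_on \<mu> S) < \<infinity>" for n
    using meas g(2) h(2) \<rho>(1,2) \<rho>'(1,2) by (auto simp: R_def)
  obtain r where r: "r \<in> borel_measurable (restrict_space borel S)"
    "(\<integral>\<^sup>+x. ennpowr (r x) p \<partial>measure_on \<mu> S) < \<infinity>"
    "\<And>\<gamma> n. \<gamma> \<in> rectifiable_curves S \<Longrightarrow> line_integral \<gamma> r < \<infinity> \<Longrightarrow> line_integral \<gamma> (R n) < \<infinity>"
    using common_exceptional_weight[of \<mu> p R S, OF assms(1,2) R] by metis
  show ?thesis
  proof (rule weak_upper_gradientI[OF assms(1,2) _ r(1,2)])
    show "(\<lambda>x. min (g x) (h x)) \<in> borel_measurable (restrict_space borel S)" using meas by measurable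
    fix \<gamma> assume \<gamma>: "\<gamma> \<in> rectifiable_curves S" "line_integral \<gamma> r < \<infinity>"
    have fin: "line_integral \<gamma> g < \<infinity>" "line_integral \<gamma> h < \<infinity>"
      "line_integral \<gamma> \<rho> < \<infinity>" "line_integral \<gamma> \<rho>' < \<infinity>"
      using r(3)[OF \<gamma>, of 0] r(3)[OF \<gamma>, of 1] r(3)[OF \<gamma>, of 2] r(3)[OF \<gamma>, of 3] by (auto simp: R_def)
    show "ug_inequality u (\<lambda>x. min (g x) (h x)) \<gamma>"
      by (rule ug_inequality_min[OF \<gamma>(1) meas fin(1,2)])
        (use \<rho> \<rho>' fin(3,4) le_less_trans in blast)
  qed
qed

text \<open>Since the sequence decreases, dominated convergence along curves takes the place of Fuglede's lemma.\<close>

lemma weak_upper_gradient_INF: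
  fixes h :: "nat \<Rightarrow> 'a::metric_space \<Rightarrow> ennreal"
  assumes "sets \<mu> = sets borel" "0 < p"
    and h: "\<And>n. weak_upper_gradient S \<mu> p u (h n)" "(\<integral>\<^sup>+x. ennpowr (h 0 x) p \<partial>measure_on \<mu> S) < \<infinity>"
    and dec: "\<And>n x. h (Suc n) x \<le> h n x"
  shows "weak_upper_gradient S \<mu> p u (\<lambda>x. INF n. h n x)"
proof -
  have meas: "h n \<in> borel_measurable (restrict_space borel S)" for n
    using h by (auto simp: weak_upper_gradient_def)
  have "\<exists>\<rho>. \<rho> \<in> borel_measurable (restrict_space borel S) \<and>
    (\<integral>\<^sup>+x. ennpowr (\<rho> x) p \<partial>measure_on \<mu> S) < \<infinity> \<and>
    (\<forall>\<gamma> \<in> rectifiable_curves S. line_integral \<gamma> \<rho> < \<infinity> \<longrightarrow> ug_inequality u (h n) \<gamma>)" for n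
    using weak_upper_gradientE[OF assms(1,2) h(1)[of n]] by metis
  then obtain \<rho> where \<rho>: "\<And>n. \<rho> n \<in> borel_measurable (restrict_space borel S)"
    "\<And>n. (\<integral>\<^sup>+x. ennpowr (\<rho> n x) p \<partial>measure_on \<mu> S) < \<infinity>"
    "\<And>n \<gamma>. \<gamma> \<in> rectifiable_curves S \<Longrightarrow> line_integral \<gamma> (\<rho> n) < \<infinity> \<Longrightarrow> ug_inequality u (h n) \<gamma>"
    by metis
  \<comment> \<open>Index 0 is reserved for \<open>h 0\<close>: its finite line integral is the
    starting point for convergence of a decreasing sequence.\<close>
  define R where "R n = (if n = 0 then h 0 else \<rho> (n - 1))" for n
  have R: "R n \<in> borel_measurable (restrict_space borel S)"
    "(\<integral>\<^sup>+x. ennpowr (R n x) p \<partial>measure_on \<mu> S) < \<infinity>" for n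
    using meas h(2) \<rho>(1,2) by (auto simp: R_def)
  obtain r where r: "r \<in> borel_measurable (restrict_space borel S)"
    "(\<integral>\<^sup>+x. ennpowr (r x) p \<partial>measure_on \<mu> S) < \<infinity>"
    "\<And>\<gamma> n. \<gamma> \<in> rectifiable_curves S \<Longrightarrow> line_integral \<gamma> r < \<infinity> \<Longrightarrow> line_integral \<gamma> (R n) < \<infinity>"
    using common_exceptional_weight[of \<mu> p R S, OF assms(1,2) R] by metis
  show ?thesis
  proof (rule weak_upper_gradientI[OF assms(1,2) _ r(1,2)])
    show "(\<lambda>x. INF n. h n x) \<in> borel_measurable (restrict_space borel S)" using meas by measurable
    fix \<gamma> assume \<gamma>: "\<gamma> \<in> rectifiable_curves S" "line_integral \<gamma> r < \<infinity>"
    have h0: "line_integral \<gamma> (h 0) < \<infinity>" using r(3)[OF \<gamma>, of 0] by (simp add: R_def)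
    have ug: "ug_inequality u (h n) \<gamma>" for n
      using r(3)[OF \<gamma>, of "Suc n"] \<rho>(3)[OF \<gamma>(1)] by (simp add: R_def)
    have fin: "\<bar>u (\<gamma> 0)\<bar> \<noteq> \<infinity>" "\<bar>u (\<gamma> 1)\<bar> \<noteq> \<infinity>"
      using ug[of 0] h0 by (auto simp: ug_inequality_def)
    then have "eabs (u (\<gamma> 1) - u (\<gamma> 0)) \<le> (INF n. line_integral \<gamma> (h n))"
      using ug by (intro INF_greatest) (auto simp: ug_inequality_def)
    then show "ug_inequality u (\<lambda>x. INF n. h n x) \<gamma>"
      using fin line_integral_INF[OF \<gamma>(1) meas dec h0] by (simp add: ug_inequality_def)
  qed
qed

lemma upper_gradient_imp_weak:
  assumes "upper_gradient S u g"
  shows "weak_upper_gradient S \<mu> p u g"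
proof -
  have "modulus S \<mu> p {} \<le> (\<integral>\<^sup>+x. ennpowr 0 p \<partial>measure_on \<mu> S)"
    unfolding modulus_def by (intro INF_lower2[of "\<lambda>_. 0"]) auto
  also have "ennpowr 0 p = 0" using ennpowr_ennreal[of 0 p] by simp
  finally have "modulus S \<mu> p {} = 0" by simp
  then show ?thesis
    using assms unfolding upper_gradient_def weak_upper_gradient_def by (intro conjI exI[of _ "{}"]) auto
qed

text \<open>Running minima of a minimizing sequence for the p-energy decrease to an admissible
  \<open>g\<close> that attains the infimum. For any competitor, its minimum with \<open>g\<close>
  is admissible and lies below \<open>g\<close>, but cannot have smaller energy; so the two agree
  almost everywhere.\<close>

lemma minimal_weak_upper_gradient_exists:
  assumes "sets \<mu> = sets borel" "0 < p"
    and g0: "weak_upper_gradient S \<mu> p u g0" "Lp_norm (measure_on \<mu> S) (ereal p) g0 < \<infinity>"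
  shows "\<exists>g. is_minimal_weak_upper_gradient S \<mu> p u g"
proof -
  define J where "J g = (\<integral>\<^sup>+x. ennpowr (g x) p \<partial>measure_on \<mu> S)" for g
  define W where "W = {g. weak_upper_gradient S \<mu> p u g \<and> J g < \<infinity>}"
  have J_mono: "J g \<le> J h" if "\<And>x. g x \<le> h x" for g h
    unfolding J_def using that assms(2) by (intro nn_integral_mono ennpowr_mono) auto
  have meas: "g \<in> borel_measurable (measure_on \<mu> S)" if "g \<in> W" for g
    using that by (intro measurable_measure_on[OF assms(1)]) (auto simp: W_def weak_upper_gradient_def)
  have min: "(\<lambda>x. min (g x) (h x)) \<in> W" if "g \<in> W" "h \<in> W" for g h
    using that J_mono[of "\<lambda>x. min (g x) (h x)" g] weak_upper_gradient_min[OF assms(1,2)]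
    by (auto simp: W_def J_def intro: le_less_trans)
  have "g0 \<in> W" using g0 by (auto simp: W_def J_def Lp_norm_finite_iff)
  then obtain a :: "nat \<Rightarrow> ennreal" where a: "range a \<subseteq> J ` W" "(INF g\<in>W. J g) = (INF n. a n)"
    using ennreal_Inf_countable_INF[of "J ` W"] by auto
  then have "\<forall>n. \<exists>g. g \<in> W \<and> a n = J g" by blast
  then obtain k where k: "\<And>n. k n \<in> W" "\<And>n. a n = J (k n)" by metis
  define h where "h = rec_nat (k 0) (\<lambda>n f x. min (f x) (k (Suc n) x))"
  have h_simps: "h 0 = k 0" "h (Suc n) = (\<lambda>x. min (h n x) (k (Suc n) x))" for n
    by (simp_all add: h_def)
  have h: "h n \<in> W" for n
    by (induction n) (use k min in \<open>auto simp: h_simps\<close>)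
  have h_le: "h n x \<le> k n x" for n x by (cases n) (auto simp: h_simps)
  define g where "g x = (INF n. h n x)" for x
  have g_le: "J g \<le> J h'" if "h' \<in> W" for h'
  proof -
    have "J g \<le> a n" for n
      unfolding k(2) by (rule J_mono) (metis INF_lower UNIV_I g_def h_le order_trans)
    then have "J g \<le> (INF n. a n)" by (intro INF_greatest)
    also have "\<dots> \<le> J h'" unfolding a(2)[symmetric] using that by (rule INF_lower)
    finally show ?thesis .
  qed
  have "weak_upper_gradient S \<mu> p u g"
    unfolding g_def using h assms(1,2)
    by (intro weak_upper_gradient_INF) (auto simp: W_def J_def h_simps(2))
  then have g: "g \<in> W" using g_le[OF \<open>g0 \<in> W\<close>] \<open>g0 \<in> W\<close> by (auto simp: W_def)
  have "AE x in measure_on \<mu> S. g x \<le> h' x" if h': "h' \<in> W" for h'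
  proof -
    note min_W = min[OF g h']
    have "AE x in measure_on \<mu> S. ennpowr (min (g x) (h' x)) p = ennpowr (g x) p"
    proof (rule AE_eq_of_nn_integral_le)
      show "(\<integral>\<^sup>+x. ennpowr (g x) p \<partial>measure_on \<mu> S) \<le> (\<integral>\<^sup>+x. ennpowr (min (g x) (h' x)) p \<partial>measure_on \<mu> S)"
        using g_le[OF min_W] by (simp add: J_def)
      show "(\<integral>\<^sup>+x. ennpowr (min (g x) (h' x)) p \<partial>measure_on \<mu> S) < \<infinity>"
        using min_W by (simp add: W_def J_def)
      show "AE x in measure_on \<mu> S. ennpowr (min (g x) (h' x)) p \<le> ennpowr (g x) p"
        using assms(2) by (intro AE_I2 ennpowr_mono) auto
    qed (use meas[OF g] meas[OF h'] in measurable)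
    then show ?thesis
    proof eventually_elim
      case (elim x)
      then have "min (g x) (h' x) = g x" using assms(2) by (metis ennpowr_root')
      then show ?case by (metis min.cobounded2)
    qed
  qed
  then have "is_minimal_weak_upper_gradient S \<mu> p u g"
    using g by (auto simp: is_minimal_weak_upper_gradient_def W_def J_def Lp_norm_finite_iff)
  then show ?thesis by blast
qed

section \<open>Combinations of Newtonian functions\<close>

text \<open>The mean value theorem is applied on the two halves of the interval, which have equal
  length; the derivative of the power is strictly increasing because p > 1.\<close>

lemma powr_midpoint_less:
  fixes x y p :: real
  assumes "1 < p" "0 \<le> x" "x < y"
  shows "((x + y) / 2) powr p < (x powr p + y powr p) / 2"
proof -
  \<comment> \<open>The left end may be 0, so continuity is used on the closed interval and the
    derivative only at points beyond \<open>a\<close>.\<close>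
  have mvt: "\<exists>z. a < z \<and> z < b \<and> b powr p - a powr p = (b - a) * (p * z powr (p - 1))"
    if "0 \<le> a" "a < b" for a b :: real
  proof -
    have der: "((\<lambda>t. t powr p) has_real_derivative p * z powr (p - 1)) (at z)" if "a < z" for z
      using that \<open>0 \<le> a\<close> by (intro has_real_derivative_powr) auto
    have "continuous_on {a..b} (\<lambda>t. t powr p)"
      using that assms by (intro continuous_on_powr') (auto intro!: continuous_intros)
    moreover have "(\<lambda>t. t powr p) differentiable (at z)" if "a < z" "z < b" for z
      using der[OF that(1)] real_differentiable_def by blast
    ultimately obtain l z where z: "a < z" "z < b" "DERIV (\<lambda>t. t powr p) z :> l"
        "b powr p - a powr p = (b - a) * l"
      using MVT[OF \<open>a < b\<close>, of "\<lambda>t. t powr p"] by blast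
    then have "l = p * z powr (p - 1)" using der DERIV_unique by blast
    then show ?thesis using z by auto
  qed
  define m where "m = (x + y) / 2"
  have m: "x < m" "m < y" "y - m = m - x" using assms by (auto simp: m_def field_simps)
  obtain s where s: "x < s" "s < m" "m powr p - x powr p = (m - x) * (p * s powr (p - 1))"
    using mvt[of x m] m assms by auto
  obtain t where t: "m < t" "t < y" "y powr p - m powr p = (m - x) * (p * t powr (p - 1))"
    using mvt[of m y] m assms by auto
  have "s powr (p - 1) < t powr (p - 1)"
    using s t assms by (intro powr_less_mono2) auto
  then have "(m - x) * (p * s powr (p - 1)) < (m - x) * (p * t powr (p - 1))"
    using m assms by (intro mult_strict_left_mono) auto
  then show ?thesis using s(3) t(3) unfolding m_def[symmetric] by simp
qed

lemma inverse_two_ennreal: "0 \<le> x \<Longrightarrow> inverse 2 * ennreal x = ennreal (x / 2)"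
  using ennreal_mult[of "1 / 2" x] by simp

lemma max_ennreal: "max (ennreal x) (ennreal y) = ennreal (max x y)"
  by (auto simp: max_def intro!: antisym ennreal_leI)

lemma ennpowr_midpoint_le:
  assumes "1 < p"
  shows "ennpowr (ennreal (1 / 2) * (a + b)) p \<le> ennreal (1 / 2) * (ennpowr a p + ennpowr b p)"
proof (cases "a = top \<or> b = top")
  case False
  then obtain x y where xy: "a = ennreal x" "0 \<le> x" "b = ennreal y" "0 \<le> y"
    by (metis ennreal_cases)
  have "((x + y) / 2) powr p \<le> (x powr p + y powr p) / 2"
    using powr_midpoint_less[OF assms, of x y] powr_midpoint_less[OF assms, of y x] xy
    by (cases x y rule: linorder_cases) (auto simp: add.commute)
  then show ?thesis using xy by (simp add: inverse_two_ennreal flip: ennreal_plus)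
qed (auto simp: ennreal_mult_top)

text \<open>Finiteness is essential: if one of the two values is infinite, both sides of the
  equation are.\<close>

lemma ennpowr_midpoint_eqD:
  assumes "1 < p" "a < top" "b < top"
    and eq: "ennpowr (ennreal (1 / 2) * (a + b)) p = ennreal (1 / 2) * (ennpowr a p + ennpowr b p)"
  shows "a = b"
proof -
  obtain x y where xy: "a = ennreal x" "0 \<le> x" "b = ennreal y" "0 \<le> y"
    using assms by (metis ennreal_cases less_irrefl)
  have "ennreal (((x + y) / 2) powr p) = ennreal ((x powr p + y powr p) / 2)"
    using eq xy by (simp add: inverse_two_ennreal flip: ennreal_plus)
  then have "((x + y) / 2) powr p = (x powr p + y powr p) / 2"
    by (subst (asm) ennreal_inj) auto
  then have "x = y"
    using powr_midpoint_less[OF assms(1), of x y] powr_midpoint_less[OF assms(1), of y x] xy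
    by (cases x y rule: linorder_cases) (auto simp: add.commute)
  then show ?thesis using xy by simp
qed

section \<open>Extended real valued functions in Lebesgue spaces\<close>

lemma eabs_simps [simp]: "eabs (ereal x) = ennreal \<bar>x\<bar>" "eabs \<infinity> = top" "eabs (-\<infinity>) = top"
  by (simp_all add: eabs_def)

lemma borel_measurable_eabs [measurable]:
  "u \<in> borel_measurable M \<Longrightarrow> (\<lambda>x. eabs (u x)) \<in> borel_measurable M"
  unfolding eabs_def by measurable

lemma in_Lp_ereal_iff:
  "in_Lp M (ereal p) u \<longleftrightarrow> u \<in> borel_measurable M \<and> (\<integral>\<^sup>+x. ennpowr (eabs (u x)) p \<partial>M) < top"
  by (simp add: in_Lp_def Lp_norm_finite_iff)

text \<open>Over a finite measure, the bound of t by 1 + t^p puts \<open>L\<^sup>p\<close> inside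
  \<open>L\<^sup>1\<close>. This justifies passing to real representatives in integrals.\<close>

lemma in_Lp_finite_measure:
  assumes "finite_measure M" "1 \<le> p" "in_Lp M (ereal p) u"
  shows in_Lp_AE_finite: "AE x in M. \<bar>u x\<bar> \<noteq> \<infinity>"
    and in_Lp_integrable: "integrable M (\<lambda>x. real_of_ereal (u x))"
proof -
  interpret finite_measure M by fact
  have [measurable]: "u \<in> borel_measurable M" and fin: "(\<integral>\<^sup>+x. ennpowr (eabs (u x)) p \<partial>M) < top"
    using assms(3) by (auto simp: in_Lp_ereal_iff)
  have "(\<integral>\<^sup>+x. eabs (u x) \<partial>M) \<le> (\<integral>\<^sup>+x. 1 + ennpowr (eabs (u x)) p \<partial>M)"
    using assms(2) by (intro nn_integral_mono le_one_add_ennpowr)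
  also have "\<dots> = emeasure M (space M) + (\<integral>\<^sup>+x. ennpowr (eabs (u x)) p \<partial>M)"
    by (subst nn_integral_add) auto
  also have "\<dots> < top" using fin emeasure_finite[of "space M"] by (simp add: less_top[symmetric])
  finally have I: "(\<integral>\<^sup>+x. eabs (u x) \<partial>M) < top" .
  then have "AE x in M. eabs (u x) \<noteq> \<infinity>"
    by (intro nn_integral_PInf_AE) auto
  then show "AE x in M. \<bar>u x\<bar> \<noteq> \<infinity>"
    by eventually_elim (auto simp: eabs_def)
  have "ennreal (norm (real_of_ereal a)) \<le> eabs a" for a
    by (cases a) auto
  then have "(\<integral>\<^sup>+x. ennreal (norm (real_of_ereal (u x))) \<partial>M) \<le> (\<integral>\<^sup>+x. eabs (u x) \<partial>M)"
    by (intro nn_integral_mono)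
  then show "integrable M (\<lambda>x. real_of_ereal (u x))"
    using I by (intro integrableI_bounded) auto
qed

text \<open>The upper gradient in the definition of the Newtonian space starts the existence
  argument and thereby gives the \<open>SOME\<close> in \<open>min_gradient\<close> its
  meaning.\<close>

lemma min_gradient_minimal:
  assumes "sets \<mu> = sets borel" "0 < p" "u \<in> newtonian S \<mu> p"
  shows "is_minimal_weak_upper_gradient S \<mu> p u (min_gradient S \<mu> p u)"
proof -
  obtain g where "upper_gradient S u g" "Lp_norm (measure_on \<mu> S) (ereal p) g < \<infinity>"
    using assms(3) by (auto simp: newtonian_def)
  then have "\<exists>g. is_minimal_weak_upper_gradient S \<mu> p u g"
    by (intro minimal_weak_upper_gradient_exists[OF assms(1,2)] upper_gradient_imp_weak)
  then show ?thesis unfolding min_gradient_def by (rule someI_ex)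
qed

text \<open>Instances: \<open>(u + v) / 2\<close> with gradient bound \<open>(g\<^sub>u + g\<^sub>v) / 2\<close>, and \<open>max u v - c\<close>, \<open>min u v - c\<close> with
  gradient bound \<open>max g\<^sub>u g\<^sub>v\<close>.\<close>

locale gradient_combination =
  fixes \<mu> :: "'a::metric_space measure" and S :: "'a set" and p :: real
    and comb :: "ereal \<Rightarrow> ereal \<Rightarrow> ereal" and gcomb :: "ennreal \<Rightarrow> ennreal \<Rightarrow> ennreal" and K :: real
  assumes sets_\<mu>: "sets \<mu> = sets borel" and p: "1 \<le> p"
    and finite_S: "finite_measure (measure_on \<mu> S)"
    and comb_finite: "\<bar>comb (ereal s) (ereal t)\<bar> \<noteq> \<infinity>"
    and comb_diff: "eabs (comb (ereal s') (ereal t') - comb (ereal s) (ereal t))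
      \<le> gcomb (ennreal \<bar>s' - s\<bar>) (ennreal \<bar>t' - t\<bar>)"
    and comb_bound: "eabs (comb a b) \<le> eabs a + eabs b + ennreal K"
    and comb_measurable: "\<And>u v. u \<in> borel_measurable (measure_on \<mu> S) \<Longrightarrow>
      v \<in> borel_measurable (measure_on \<mu> S) \<Longrightarrow> (\<lambda>x. comb (u x) (v x)) \<in> borel_measurable (measure_on \<mu> S)"
    and gcomb_mono: "\<And>c c' d d'. c \<le> c' \<Longrightarrow> d \<le> d' \<Longrightarrow> gcomb c d \<le> gcomb c' d'"
    and gcomb_top: "gcomb top d = top" "gcomb c top = top"
    and gcomb_bound: "gcomb c d \<le> c + d"
    and gcomb_measurable: "\<And>g h (M :: 'a measure). g \<in> borel_measurable M \<Longrightarrow> h \<in> borel_measurable M \<Longrightarrow>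
      (\<lambda>x. gcomb (g x) (h x)) \<in> borel_measurable M"
    and gcomb_line_integral: "\<And>\<gamma> g h. \<gamma> \<in> rectifiable_curves S \<Longrightarrow>
      g \<in> borel_measurable (restrict_space borel S) \<Longrightarrow> h \<in> borel_measurable (restrict_space borel S) \<Longrightarrow>
      gcomb (line_integral \<gamma> g) (line_integral \<gamma> h) \<le> line_integral \<gamma> (\<lambda>x. gcomb (g x) (h x))"
begin

lemma ug_inequality_comb:
  assumes "\<gamma> \<in> rectifiable_curves S"
    and "g \<in> borel_measurable (restrict_space borel S)" "h \<in> borel_measurable (restrict_space borel S)"
    and ug: "ug_inequality u g \<gamma>" "ug_inequality v h \<gamma>"
  shows "ug_inequality (\<lambda>x. comb (u x) (v x)) (\<lambda>x. gcomb (g x) (h x)) \<gamma>"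
\<comment> \<open>An infinite line integral makes that of the combined gradient infinite, and the
  inequality is trivial. Otherwise both functions are finite at both ends, where the locale
  assumptions about reals apply.\<close>
proof (cases "line_integral \<gamma> g = top \<or> line_integral \<gamma> h = top")
  case True
  then have "line_integral \<gamma> (\<lambda>x. gcomb (g x) (h x)) = top"
    using gcomb_line_integral[OF assms(1-3)] by (auto simp: gcomb_top top_unique)
  then show ?thesis by (simp add: ug_inequality_def)
next
  case False
  have fin: "\<bar>u (\<gamma> 0)\<bar> \<noteq> \<infinity>" "\<bar>u (\<gamma> 1)\<bar> \<noteq> \<infinity>" "\<bar>v (\<gamma> 0)\<bar> \<noteq> \<infinity>" "\<bar>v (\<gamma> 1)\<bar> \<noteq> \<infinity>"
    using ug False by (auto simp: ug_inequality_def split: if_splits)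
  then obtain s s' t t' where eq: "u (\<gamma> 0) = ereal s" "u (\<gamma> 1) = ereal s'" "v (\<gamma> 0) = ereal t" "v (\<gamma> 1) = ereal t'"
    by auto
  have "eabs (comb (ereal s') (ereal t') - comb (ereal s) (ereal t))
      \<le> gcomb (ennreal \<bar>s' - s\<bar>) (ennreal \<bar>t' - t\<bar>)"
    by (rule comb_diff)
  also have "\<dots> \<le> gcomb (line_integral \<gamma> g) (line_integral \<gamma> h)"
    using ug eq by (intro gcomb_mono) (auto simp: ug_inequality_def)
  also have "\<dots> \<le> line_integral \<gamma> (\<lambda>x. gcomb (g x) (h x))"
    by (rule gcomb_line_integral[OF assms(1-3)])
  finally show ?thesis using comb_finite eq by (simp add: ug_inequality_def)
qed

lemma weak_upper_gradient_comb:
  assumes "weak_upper_gradient S \<mu> p u g" "weak_upper_gradient S \<mu> p v h"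
  shows "weak_upper_gradient S \<mu> p (\<lambda>x. comb (u x) (v x)) (\<lambda>x. gcomb (g x) (h x))"
proof -
  have p0: "0 < p" using p by simp
  have meas: "g \<in> borel_measurable (restrict_space borel S)" "h \<in> borel_measurable (restrict_space borel S)"
    using assms by (auto simp: weak_upper_gradient_def)
  obtain \<rho> where \<rho>: "\<rho> \<in> borel_measurable (restrict_space borel S)"
    "(\<integral>\<^sup>+x. ennpowr (\<rho> x) p \<partial>measure_on \<mu> S) < \<infinity>"
    "\<And>\<gamma>. \<gamma> \<in> rectifiable_curves S \<Longrightarrow> line_integral \<gamma> \<rho> < \<infinity> \<Longrightarrow> ug_inequality u g \<gamma>"
    using weak_upper_gradientE[OF sets_\<mu> p0 assms(1)] by metis
  obtain \<rho>' where \<rho>': "\<rho>' \<in> borel_measurable (restrict_space borel S)"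
    "(\<integral>\<^sup>+x. ennpowr (\<rho>' x) p \<partial>measure_on \<mu> S) < \<infinity>"
    "\<And>\<gamma>. \<gamma> \<in> rectifiable_curves S \<Longrightarrow> line_integral \<gamma> \<rho>' < \<infinity> \<Longrightarrow> ug_inequality v h \<gamma>"
    using weak_upper_gradientE[OF sets_\<mu> p0 assms(2)] by metis
  define R where "R n = (if n = 0 then \<rho> else \<rho>')" for n :: nat
  have R: "R n \<in> borel_measurable (restrict_space borel S)"
    "(\<integral>\<^sup>+x. ennpowr (R n x) p \<partial>measure_on \<mu> S) < \<infinity>" for n
    using \<rho>(1,2) \<rho>'(1,2) by (auto simp: R_def)
  obtain r where r: "r \<in> borel_measurable (restrict_space borel S)"
    "(\<integral>\<^sup>+x. ennpowr (r x) p \<partial>measure_on \<mu> S) < \<infinity>"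
    "\<And>\<gamma> n. \<gamma> \<in> rectifiable_curves S \<Longrightarrow> line_integral \<gamma> r < \<infinity> \<Longrightarrow> line_integral \<gamma> (R n) < \<infinity>"
    using common_exceptional_weight[of \<mu> p R S, OF sets_\<mu> p0 R] by metis
  show ?thesis
  proof (rule weak_upper_gradientI[OF sets_\<mu> p0 gcomb_measurable[OF meas] r(1,2)])
    fix \<gamma> assume \<gamma>: "\<gamma> \<in> rectifiable_curves S" "line_integral \<gamma> r < \<infinity>"
    then have "ug_inequality u g \<gamma>" "ug_inequality v h \<gamma>"
      using \<rho>(3)[OF \<gamma>(1)] \<rho>'(3)[OF \<gamma>(1)] r(3)[OF \<gamma>, of 0] r(3)[OF \<gamma>, of 1] by (auto simp: R_def)
    then show "ug_inequality (\<lambda>x. comb (u x) (v x)) (\<lambda>x. gcomb (g x) (h x)) \<gamma>"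
      by (rule ug_inequality_comb[OF \<gamma>(1) meas])
  qed
qed

lemma Lp_norm_gcomb_finite:
  assumes "g \<in> borel_measurable (restrict_space borel S)" "h \<in> borel_measurable (restrict_space borel S)"
    and "Lp_norm (measure_on \<mu> S) (ereal p) g < top" "Lp_norm (measure_on \<mu> S) (ereal p) h < top"
  shows "Lp_norm (measure_on \<mu> S) (ereal p) (\<lambda>x. gcomb (g x) (h x)) < top"
proof -
  note [measurable] = assms(1,2)[THEN measurable_measure_on[OF sets_\<mu>]]
  have "(\<integral>\<^sup>+x. ennpowr (gcomb (g x) (h x)) p \<partial>measure_on \<mu> S)
      \<le> (\<integral>\<^sup>+x. ennreal (2 powr p) * (ennpowr (g x) p + ennpowr (h x) p) \<partial>measure_on \<mu> S)"
    using p by (intro nn_integral_mono order_trans[OF ennpowr_mono[OF _ gcomb_bound] ennpowr_add_le]) auto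
  also have "\<dots> = ennreal (2 powr p) * ((\<integral>\<^sup>+x. ennpowr (g x) p \<partial>measure_on \<mu> S) + (\<integral>\<^sup>+x. ennpowr (h x) p \<partial>measure_on \<mu> S))"
    by (simp add: nn_integral_cmult nn_integral_add)
  also have "\<dots> < top" using assms(3,4) by (simp add: Lp_norm_finite_iff ennreal_mult_less_top)
  finally show ?thesis by (simp add: Lp_norm_finite_iff)
qed

text \<open>The additive constant \<open>K\<close> in the bound on \<open>comb\<close> is harmless
  because constants are in \<open>L\<^sup>p\<close> over a finite measure.\<close>

lemma newtonian_comb:
  assumes u: "u \<in> newtonian S \<mu> p" and v: "v \<in> newtonian S \<mu> p"
  shows "(\<lambda>x. comb (u x) (v x)) \<in> newtonian S \<mu> p"
proof -
  let ?N = "measure_on \<mu> S"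
  interpret finite_measure ?N by (rule finite_S)
  have [measurable]: "u \<in> borel_measurable ?N" "v \<in> borel_measurable ?N"
    and fin: "(\<integral>\<^sup>+x. ennpowr (eabs (u x)) p \<partial>?N) < top" "(\<integral>\<^sup>+x. ennpowr (eabs (v x)) p \<partial>?N) < top"
    using u v by (auto simp: newtonian_def in_Lp_ereal_iff)
  obtain g h where gh: "upper_gradient S u g" "Lp_norm ?N (ereal p) g < top"
    "upper_gradient S v h" "Lp_norm ?N (ereal p) h < top"
    using u v by (auto simp: newtonian_def)
  have meas: "g \<in> borel_measurable (restrict_space borel S)" "h \<in> borel_measurable (restrict_space borel S)"
    using gh by (auto simp: upper_gradient_def)
  have "upper_gradient S (\<lambda>x. comb (u x) (v x)) (\<lambda>x. gcomb (g x) (h x))"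
    using gh gcomb_measurable[OF meas] ug_inequality_comb[OF _ meas] by (auto simp: upper_gradient_def)
  moreover have "(\<integral>\<^sup>+x. ennpowr (eabs (comb (u x) (v x))) p \<partial>?N) < top"
  proof -
    let ?C = "ennreal (2 powr p)" and ?k = "ennpowr (ennreal K) p"
    have "ennpowr (eabs (comb (u x) (v x))) p
        \<le> ?C * (?C * (ennpowr (eabs (u x)) p + ennpowr (eabs (v x)) p) + ?k)" for x
    proof -
      have "ennpowr (eabs (comb (u x) (v x))) p \<le> ennpowr ((eabs (u x) + eabs (v x)) + ennreal K) p"
        using p by (intro ennpowr_mono comb_bound) auto
      also have "\<dots> \<le> ?C * (ennpowr (eabs (u x) + eabs (v x)) p + ?k)"
        using p by (intro ennpowr_add_le) auto
      also have "\<dots> \<le> ?C * (?C * (ennpowr (eabs (u x)) p + ennpowr (eabs (v x)) p) + ?k)"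
        using p by (intro mult_left_mono add_mono ennpowr_add_le) auto
      finally show ?thesis .
    qed
    then have "(\<integral>\<^sup>+x. ennpowr (eabs (comb (u x) (v x))) p \<partial>?N)
        \<le> (\<integral>\<^sup>+x. ?C * (?C * (ennpowr (eabs (u x)) p + ennpowr (eabs (v x)) p) + ?k) \<partial>?N)"
      by (intro nn_integral_mono)
    also have "\<dots> = ?C * (?C * ((\<integral>\<^sup>+x. ennpowr (eabs (u x)) p \<partial>?N) + (\<integral>\<^sup>+x. ennpowr (eabs (v x)) p \<partial>?N))
        + ?k * emeasure ?N (space ?N))"
      by (simp add: nn_integral_cmult nn_integral_add)
    also have "\<dots> < top"
    proof -
      have "emeasure ?N (space ?N) < top" using emeasure_finite by (simp add: less_top[symmetric])
      then show ?thesis using fin by (simp add: ennreal_mult_less_top ennpowr_finite_iff)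
    qed
    finally show ?thesis .
  qed
  ultimately show ?thesis
    using comb_measurable[of u v] Lp_norm_gcomb_finite[OF meas] gh
    by (auto simp: newtonian_def in_Lp_ereal_iff)
qed

lemma min_gradient_comb_le:
  assumes u: "u \<in> newtonian S \<mu> p" and v: "v \<in> newtonian S \<mu> p"
  shows "AE x in measure_on \<mu> S. min_gradient S \<mu> p (\<lambda>x. comb (u x) (v x)) x
    \<le> gcomb (min_gradient S \<mu> p u x) (min_gradient S \<mu> p v x)"
proof -
  have p0: "0 < p" using p by simp
  note min = min_gradient_minimal[OF sets_\<mu> p0]
  have "weak_upper_gradient S \<mu> p (\<lambda>x. comb (u x) (v x))
      (\<lambda>x. gcomb (min_gradient S \<mu> p u x) (min_gradient S \<mu> p v x))"
    using min[OF u] min[OF v] by (intro weak_upper_gradient_comb) (auto simp: is_minimal_weak_upper_gradient_def)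
  moreover have "Lp_norm (measure_on \<mu> S) (ereal p)
      (\<lambda>x. gcomb (min_gradient S \<mu> p u x) (min_gradient S \<mu> p v x)) < \<infinity>"
    using min[OF u] min[OF v] Lp_norm_gcomb_finite
    by (auto simp: is_minimal_weak_upper_gradient_def weak_upper_gradient_def)
  ultimately show ?thesis
    using min[OF newtonian_comb[OF u v]] by (auto simp: is_minimal_weak_upper_gradient_def)
qed

end

section \<open>The midpoint, the maximum and the minimum as instances\<close>

lemma gradient_combination_mean:
  assumes "sets \<mu> = sets borel" "1 \<le> p" "finite_measure (measure_on \<mu> S)"
  shows "gradient_combination \<mu> S p (\<lambda>a b. ereal (1 / 2) * a + ereal (1 / 2) * b)
    (\<lambda>a b. ennreal (1 / 2) * (a + b)) 0"
proof (rule gradient_combination.intro)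
  fix s t s' t' :: real
  have "\<bar>(s' + t') / 2 - (s + t) / 2\<bar> \<le> (\<bar>s' - s\<bar> + \<bar>t' - t\<bar>) / 2" by (auto simp: abs_if field_simps)
  then show "eabs (ereal (1 / 2) * ereal s' + ereal (1 / 2) * ereal t' - (ereal (1 / 2) * ereal s + ereal (1 / 2) * ereal t))
      \<le> ennreal (1 / 2) * (ennreal \<bar>s' - s\<bar> + ennreal \<bar>t' - t\<bar>)"
    by (simp add: inverse_two_ennreal add_divide_distrib flip: ennreal_plus)
  fix a b :: ereal
  show "eabs (ereal (1 / 2) * a + ereal (1 / 2) * b) \<le> eabs a + eabs b + ennreal 0"
    by (cases a; cases b) (auto simp: abs_if simp flip: ennreal_plus)
next
  fix c d c' d' :: ennreal
  show "ennreal (1 / 2) * (c + d) \<le> ennreal (1 / 2) * (c' + d')" if "c \<le> c'" "d \<le> d'"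
    by (rule mult_left_mono[OF add_mono[OF that]]) simp
next
  fix c d :: ennreal
  have "ennreal (1 / 2) * (c + d) \<le> 1 * (c + d)"
    by (intro mult_right_mono) (simp_all del: ennreal_half)
  then show "ennreal (1 / 2) * (c + d) \<le> c + d" by simp
next
  fix \<gamma> and g h :: "'a \<Rightarrow> ennreal"
  assume *: "\<gamma> \<in> rectifiable_curves S" "g \<in> borel_measurable (restrict_space borel S)"
    "h \<in> borel_measurable (restrict_space borel S)"
  then have m: "(\<lambda>x. g x + h x) \<in> borel_measurable (restrict_space borel S)" by measurable
  show "ennreal (1 / 2) * (line_integral \<gamma> g + line_integral \<gamma> h) \<le> line_integral \<gamma> (\<lambda>x. ennreal (1 / 2) * (g x + h x))"
    unfolding line_integral_cmult[OF *(1) m] line_integral_add[OF *] by (rule order.refl)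
qed (use assms in \<open>simp_all add: ennreal_mult_top\<close>)

text \<open>The maximum is 1-Lipschitz for the larger of the two coordinate distances, and
  \<open>c\<close> cancels in increments. The larger of two line integrals is at most the line
  integral of the pointwise maximum.\<close>

lemma gradient_combination_max:
  assumes "sets \<mu> = sets borel" "1 \<le> p" "finite_measure (measure_on \<mu> S)"
  shows "gradient_combination \<mu> S p (\<lambda>a b. max a b - ereal c) max \<bar>c\<bar>"
proof (rule gradient_combination.intro)
  fix s t s' t' :: real
  have "\<bar>(max s' t' - c) - (max s t - c)\<bar> \<le> max \<bar>s' - s\<bar> \<bar>t' - t\<bar>" by (auto simp: max_def abs_if)
  then show "eabs (max (ereal s') (ereal t') - ereal c - (max (ereal s) (ereal t) - ereal c))
      \<le> max (ennreal \<bar>s' - s\<bar>) (ennreal \<bar>t' - t\<bar>)"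
    by (simp add: max_ennreal flip: ereal_max)
  show "\<bar>max (ereal s) (ereal t) - ereal c\<bar> \<noteq> \<infinity>" by (simp flip: ereal_max)
  fix a b :: ereal
  show "eabs (max a b - ereal c) \<le> eabs a + eabs b + ennreal \<bar>c\<bar>"
    by (cases a; cases b) (auto simp: max_def abs_if simp flip: ennreal_plus)
next
  fix \<gamma> and g h :: "'a \<Rightarrow> ennreal"
  show "max (line_integral \<gamma> g) (line_integral \<gamma> h) \<le> line_integral \<gamma> (\<lambda>x. max (g x) (h x))"
    by (intro max.boundedI line_integral_mono) auto
qed (use assms in \<open>auto simp: max_def top_unique add_increasing add_increasing2 split: if_splits\<close>)

lemma gradient_combination_min:
  assumes "sets \<mu> = sets borel" "1 \<le> p" "finite_measure (measure_on \<mu> S)"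
  shows "gradient_combination \<mu> S p (\<lambda>a b. min a b - ereal c) max \<bar>c\<bar>"
proof (rule gradient_combination.intro)
  fix s t s' t' :: real
  have "\<bar>(min s' t' - c) - (min s t - c)\<bar> \<le> max \<bar>s' - s\<bar> \<bar>t' - t\<bar>" by (auto simp: min_def abs_if)
  then show "eabs (min (ereal s') (ereal t') - ereal c - (min (ereal s) (ereal t) - ereal c))
      \<le> max (ennreal \<bar>s' - s\<bar>) (ennreal \<bar>t' - t\<bar>)"
    by (simp add: max_ennreal flip: ereal_min)
  show "\<bar>min (ereal s) (ereal t) - ereal c\<bar> \<noteq> \<infinity>" by (simp flip: ereal_min)
  fix a b :: ereal
  show "eabs (min a b - ereal c) \<le> eabs a + eabs b + ennreal \<bar>c\<bar>"
    by (cases a; cases b) (auto simp: min_def abs_if simp flip: ennreal_plus)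
next
  fix \<gamma> and g h :: "'a \<Rightarrow> ennreal"
  show "max (line_integral \<gamma> g) (line_integral \<gamma> h) \<le> line_integral \<gamma> (\<lambda>x. max (g x) (h x))"
    by (intro max.boundedI line_integral_mono) auto
qed (use assms in \<open>auto simp: max_def top_unique add_increasing add_increasing2 split: if_splits\<close>)

section \<open>Minimizers\<close>

lemma minimizers_iff:
  "u \<in> minimizers \<mu> \<Omega> p T f \<longleftrightarrow> u \<in> newtonian_mean_zero \<Omega> \<mu> p \<and>
    (\<forall>v\<in>newtonian_mean_zero \<Omega> \<mu> p. energy \<mu> \<Omega> p T f u \<le> energy \<mu> \<Omega> p T f v)"
  (is "?l \<longleftrightarrow> ?r")
proof
  assume ?l
  then have "u \<in> newtonian_mean_zero \<Omega> \<mu> p"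
    and eq: "ereal (energy \<mu> \<Omega> p T f u) = (INF v \<in> newtonian_mean_zero \<Omega> \<mu> p. ereal (energy \<mu> \<Omega> p T f v))"
    by (auto simp: minimizers_def)
  moreover have "energy \<mu> \<Omega> p T f u \<le> energy \<mu> \<Omega> p T f v"
    if "v \<in> newtonian_mean_zero \<Omega> \<mu> p" for v
  proof -
    have "ereal (energy \<mu> \<Omega> p T f u) \<le> ereal (energy \<mu> \<Omega> p T f v)"
      unfolding eq using that by (rule INF_lower)
    then show ?thesis by simp
  qed
  ultimately show ?r by blast
next
  assume ?r
  then show ?l
    unfolding minimizers_def by (auto intro!: antisym INF_lower INF_greatest)
qed

lemma emeasure_bounded_open:
  assumes "doubling \<mu>" "sets \<mu> = sets borel" "open \<Omega>" "\<Omega> \<noteq> {}" "bounded \<Omega>"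
  shows "0 < emeasure \<mu> \<Omega>" "emeasure \<mu> \<Omega> < top"
proof -
  have pos: "0 < emeasure \<mu> (ball z (2 * r))" and fin: "emeasure \<mu> (ball z r) < top" if "0 < r" for z r
    using assms(1) that by (auto simp: doubling_def)
  obtain z e where "0 < e" "ball z e \<subseteq> \<Omega>"
    using assms(3,4) open_contains_ball by blast
  \<comment> \<open>The doubling condition states positivity for balls of radius 2r, hence it is
    applied with r = e / 2.\<close>
  then have "0 < emeasure \<mu> (ball z e)" "emeasure \<mu> (ball z e) \<le> emeasure \<mu> \<Omega>"
    using pos[of "e / 2" z] assms by (auto intro!: emeasure_mono)
  then show "0 < emeasure \<mu> \<Omega>" by (rule less_le_trans)
  obtain r where "\<Omega> \<subseteq> ball z r" "0 < r"
    using bounded_subset_ballD[OF assms(5)] by blast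
  then have "emeasure \<mu> \<Omega> \<le> emeasure \<mu> (ball z r)" "emeasure \<mu> (ball z r) < top"
    using assms(2) fin by (auto intro!: emeasure_mono)
  then show "emeasure \<mu> \<Omega> < top" by (rule le_less_trans)
qed

lemma space_measure_on:
  assumes "sets \<mu> = sets borel"
  shows "space (measure_on \<mu> S) = S"
  using sets_eq_imp_space_eq[OF assms] by (simp add: measure_on_def space_restrict_space)

lemma emeasure_measure_on:
  assumes "sets \<mu> = sets borel" "S \<in> sets borel"
  shows "emeasure (measure_on \<mu> S) S = emeasure \<mu> S"
  using assms sets_eq_imp_space_eq[OF assms(1)]
  by (simp add: measure_on_def emeasure_restrict_space)

theorem lemma4p5:
  fixes \<mu> :: "'a::complete_space measure" and \<Omega> :: "'a set"
    and p s lam :: real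
    and T :: "('a \<Rightarrow> ereal) \<Rightarrow> 'a \<Rightarrow> real" and f :: "'a \<Rightarrow> real"
    and u v :: "'a \<Rightarrow> ereal"
  assumes "1 < p"
    and "sets \<mu> = sets borel" and "doubling \<mu>"
    and "1 < s" and "lower_mass_bound \<mu> s"
    and "1 \<le> lam" and "poincare_inequality UNIV \<mu> p lam"
    and "open \<Omega>" and "connected \<Omega>" and "\<Omega> \<noteq> {}" and "bounded \<Omega>"
    and "perimeter \<mu> \<Omega> UNIV < \<infinity>" and "emeasure \<mu> (UNIV - \<Omega>) > 0"
    and "boundary_regular \<mu> \<Omega>"
    and "poincare_inequality \<Omega> \<mu> p 1"
    and "is_trace_operator \<mu> \<Omega> p s T"
    and "f \<in> borel_measurable (boundary_measure \<mu> \<Omega>)" and "bounded (f ` frontier \<Omega>)"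
    and "boundary_integral \<mu> \<Omega> f = 0"
    and "u \<in> minimizers \<mu> \<Omega> p T f" and "v \<in> minimizers \<mu> \<Omega> p T f"
  shows "boundary_integral \<mu> \<Omega> (\<lambda>x. T u x * f x) = boundary_integral \<mu> \<Omega> (\<lambda>x. T v x * f x)
    \<and> (AE x in measure_on \<mu> \<Omega>. min_gradient \<Omega> \<mu> p u x = min_gradient \<Omega> \<mu> p v x)
    \<and> (\<lambda>x. max (u x) (v x) - ereal (mean \<mu> \<Omega> (\<lambda>y. max (u y) (v y))))
        \<in> minimizers \<mu> \<Omega> p T f
    \<and> (\<lambda>x. min (u x) (v x) - ereal (mean \<mu> \<Omega> (\<lambda>y. min (u y) (v y))))
        \<in> minimizers \<mu> \<Omega> p T f"
proof -
  define N where "N = measure_on \<mu> \<Omega>"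
  define M where "M = boundary_measure \<mu> \<Omega>"
  define B where "B w = boundary_integral \<mu> \<Omega> (\<lambda>x. T w x * f x)" for w
  define J where "J w = (\<integral>\<^sup>+x. ennpowr (min_gradient \<Omega> \<mu> p w x) p \<partial>N)" for w
  define I where "I w = integral_on \<mu> \<Omega> w" for w
  define V where "V = newtonian \<Omega> \<mu> p"
  have energy: "energy \<mu> \<Omega> p T f w = enn2real (J w) + B w" for w
    by (simp add: energy_def J_def B_def N_def)
  have p: "1 \<le> p" "0 < p" using assms(1) by auto
  note sets = assms(2)

  have mass: "0 < emeasure \<mu> \<Omega>" "emeasure \<mu> \<Omega> < top"
    using emeasure_bounded_open assms by blast+
  have spN: "space N = \<Omega>" and emN: "emeasure N \<Omega> = emeasure \<mu> \<Omega>"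
    using space_measure_on[OF sets] emeasure_measure_on[OF sets] assms(8) by (auto simp: N_def)
  have finN: "finite_measure N"
    using mass by (intro finite_measureI) (simp add: spN emN less_top[symmetric])
  have fin': "finite_measure (measure_on \<mu> \<Omega>)" using finN by (simp add: N_def)
  have mass': "0 < measure \<mu> \<Omega>" "measure N \<Omega> = measure \<mu> \<Omega>"
    using mass by (auto simp: measure_def emN enn2real_positive_iff)

  have VN: "AE x in N. \<bar>w x\<bar> \<noteq> \<infinity>" "integrable N (\<lambda>x. real_of_ereal (w x))" if "w \<in> V" for w
    using that in_Lp_finite_measure[OF finN p(1)] by (auto simp: V_def N_def newtonian_def)
  \<comment> \<open>The constant term accounts for the means subtracted in the definitions of the
    two new functions.\<close>
  have I_lin: "I w = a * I w1 + b * I w2 + c * measure \<mu> \<Omega>"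
    if w: "w \<in> V" "w1 \<in> V" "w2 \<in> V" and eq: "AE x in N. w x = ereal a * w1 x + ereal b * w2 x + ereal c"
    for w w1 w2 a b c
  proof -
    interpret finite_measure N by (rule finN)
    have "I w = (LINT x|N. a * real_of_ereal (w1 x) + b * real_of_ereal (w2 x) + c)"
      unfolding I_def integral_on_def N_def[symmetric]
    proof (rule integral_cong_AE)
      show "(\<lambda>x. real_of_ereal (w x)) \<in> borel_measurable N"
        using VN(2)[OF w(1)] by auto
      show "(\<lambda>x. a * real_of_ereal (w1 x) + b * real_of_ereal (w2 x) + c) \<in> borel_measurable N"
        using VN(2)[OF w(2)] VN(2)[OF w(3)] by auto
      show "AE x in N. real_of_ereal (w x) = a * real_of_ereal (w1 x) + b * real_of_ereal (w2 x) + c"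
        using eq VN(1)[OF w(2)] VN(1)[OF w(3)] by eventually_elim auto
    qed
    also have "\<dots> = a * I w1 + b * I w2 + c * measure \<mu> \<Omega>"
      using VN(2)[OF w(2)] VN(2)[OF w(3)] mass'(2)
      by (simp add: I_def integral_on_def N_def[symmetric] spN)
    finally show ?thesis .
  qed

  have TL: "T w \<in> borel_measurable M" "integrable M (T w)" if "w \<in> V" for w
  proof -
    \<comment> \<open>Exponent 1 is admissible for the trace: if p < s, then 1 < p makes (s - 1)/(s
      - p) exceed 1, so the critical exponent exceeds p; if p is at least s, it is infinite.\<close>
    have "s * p - p * p < s * p - p" if "p < s" using assms(1) by simp
    then have "trace_exponent p s (ereal 1)"
      using assms(1,4) by (auto simp: trace_exponent_def field_simps one_ereal_def)
    then have "in_Lp M (ereal 1) (\<lambda>x. ereal (T w x))"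
      using assms(16) that unfolding is_trace_operator_def V_def M_def by blast
    then have *: "(\<lambda>x. ereal (T w x)) \<in> borel_measurable M" "(\<integral>\<^sup>+x. ennreal \<bar>T w x\<bar> \<partial>M) < top"
      by (auto simp: in_Lp_ereal_iff)
    then show "T w \<in> borel_measurable M" by (simp add: borel_measurable_ereal_iff)
    then show "integrable M (T w)" using * by (intro integrableI_bounded) auto
  qed
  obtain K where K: "\<And>x. x \<in> frontier \<Omega> \<Longrightarrow> \<bar>f x\<bar> \<le> K"
    using assms(18) by (auto simp: bounded_iff)
  have spM: "space M \<subseteq> frontier \<Omega>"
    by (auto simp: M_def boundary_measure_def measure_on_def space_restrict_space)
  have f: "f \<in> borel_measurable M" using assms(17) by (simp add: M_def)
  \<comment> \<open>An integrable trace times a bounded function; the bound on \<open>f\<close>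
    holds on the frontier, which contains the space of \<open>M\<close>.\<close>
  have TfI: "integrable M (\<lambda>x. T w x * f x)" if "w \<in> V" for w
  proof (rule Bochner_Integration.integrable_bound)
    show "integrable M (\<lambda>x. T w x * K)" using TL(2)[OF that] by simp
    show "(\<lambda>x. T w x * f x) \<in> borel_measurable M" using TL(1)[OF that] f by measurable
    show "AE x in M. norm (T w x * f x) \<le> norm (T w x * K)"
      using K spM by (intro AE_I2) (force simp: abs_mult intro!: mult_left_mono)
  qed
  have B_lin: "B w = a * B w1 + b * B w2"
    if w: "w \<in> V" "w1 \<in> V" "w2 \<in> V" and eq: "AE x in N. w x = ereal a * w1 x + ereal b * w2 x"
    for w w1 w2 a b
  proof -
    have T: "AE x in M. T w x = a * T w1 x + b * T w2 x"
      using assms(16) w eq unfolding is_trace_operator_def V_def M_def N_def by blast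
    have "B w = (LINT x|M. a * (T w1 x * f x) + b * (T w2 x * f x))"
      unfolding B_def boundary_integral_def M_def[symmetric]
    proof (rule integral_cong_AE)
      show "(\<lambda>x. T w x * f x) \<in> borel_measurable M"
        "(\<lambda>x. a * (T w1 x * f x) + b * (T w2 x * f x)) \<in> borel_measurable M"
        using TL(1) w f by measurable
      show "AE x in M. T w x * f x = a * (T w1 x * f x) + b * (T w2 x * f x)"
        using T by eventually_elim (simp add: algebra_simps)
    qed
    also have "\<dots> = a * B w1 + b * B w2"
      using TfI w by (simp add: B_def boundary_integral_def M_def[symmetric])
    finally show ?thesis .
  qed

  have uv: "u \<in> V" "v \<in> V" "I u = 0" "I v = 0"
    using assms(20,21) by (auto simp: minimizers_iff newtonian_mean_zero_def V_def I_def)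
  have min: "enn2real (J u) + B u \<le> enn2real (J w) + B w" "enn2real (J v) + B v \<le> enn2real (J w) + B w"
    if "w \<in> V" "I w = 0" for w
    using assms(20,21) that
    by (auto simp: minimizers_iff newtonian_mean_zero_def V_def I_def energy[symmetric])
  have eq: "enn2real (J u) + B u = enn2real (J v) + B v"
    using min[OF uv(1,3)] min[OF uv(2,4)] by linarith
  have grad: "min_gradient \<Omega> \<mu> p w \<in> borel_measurable N" "J w < top" if "w \<in> V" for w
  proof -
    have "is_minimal_weak_upper_gradient \<Omega> \<mu> p w (min_gradient \<Omega> \<mu> p w)"
      using min_gradient_minimal[OF sets p(2)] that by (simp add: V_def)
    then have "min_gradient \<Omega> \<mu> p w \<in> borel_measurable (restrict_space borel \<Omega>)"
      "Lp_norm N (ereal p) (min_gradient \<Omega> \<mu> p w) < \<infinity>"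
      by (auto simp: is_minimal_weak_upper_gradient_def weak_upper_gradient_def N_def)
    then show "min_gradient \<Omega> \<mu> p w \<in> borel_measurable N" "J w < top"
      using measurable_measure_on[OF sets] by (auto simp: N_def J_def Lp_norm_finite_iff)
  qed
  \<comment> \<open>Since \<open>enn2real\<close> sends infinity to 0, monotonicity requires the
    larger integral to be finite.\<close>
  have J_le: "enn2real (J w) \<le> enn2real (\<integral>\<^sup>+x. ennpowr (g x) p \<partial>N)"
    if "AE x in N. min_gradient \<Omega> \<mu> p w x \<le> g x" "(\<integral>\<^sup>+x. ennpowr (g x) p \<partial>N) < top" for w g
  proof -
    have "AE x in N. ennpowr (min_gradient \<Omega> \<mu> p w x) p \<le> ennpowr (g x) p"
      using that(1) by eventually_elim (use p in \<open>simp add: ennpowr_mono\<close>)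
    then show ?thesis
      unfolding J_def using that(2) by (intro enn2real_mono nn_integral_mono_AE)
  qed

  let ?gu = "min_gradient \<Omega> \<mu> p u" and ?gv = "min_gradient \<Omega> \<mu> p v"
  note [measurable] = grad(1)[OF uv(1)] grad(1)[OF uv(2)]
  define z where "z x = ereal (1 / 2) * u x + ereal (1 / 2) * v x" for x
  interpret mean: gradient_combination \<mu> \<Omega> p "\<lambda>a b. ereal (1 / 2) * a + ereal (1 / 2) * b"
      "\<lambda>a b. ennreal (1 / 2) * (a + b)" 0
    by (rule gradient_combination_mean[OF sets p(1) fin'])
  have z: "z \<in> V"
    using mean.newtonian_comb[OF uv(1,2)[unfolded V_def]] unfolding z_def V_def .
  have Bz: "B z = 1 / 2 * B u + 1 / 2 * B v" by (rule B_lin[OF z uv(1,2)]) (simp add: z_def)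
  have "I z = 1 / 2 * I u + 1 / 2 * I v + 0 * measure \<mu> \<Omega>"
    by (rule I_lin[OF z uv(1,2)]) (simp add: z_def zero_ereal_def[symmetric])
  then have Iz: "I z = 0" using uv by simp
  \<comment> \<open>These are the two sides of midpoint convexity: \<open>b\<close> integrates to
    the mean of the two gradient energies, and \<open>a\<close> bounds the gradient energy density
    of \<open>z\<close>.\<close>
  define a where "a x = ennpowr (ennreal (1 / 2) * (?gu x + ?gv x)) p" for x
  define b where "b x = ennreal (1 / 2) * (ennpowr (?gu x) p + ennpowr (?gv x) p)" for x
  have [measurable]: "a \<in> borel_measurable N" "b \<in> borel_measurable N"
    unfolding a_def b_def by measurable
  have ab: "a x \<le> b x" for x unfolding a_def b_def by (rule ennpowr_midpoint_le[OF assms(1)])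
  have Ib: "(\<integral>\<^sup>+x. b x \<partial>N) = ennreal (1 / 2) * (J u + J v)"
    unfolding b_def J_def by (subst nn_integral_cmult) (auto simp: nn_integral_add)
  define iA where "iA = enn2real (\<integral>\<^sup>+x. a x \<partial>N)"
  define iB where "iB = enn2real (\<integral>\<^sup>+x. b x \<partial>N)"
  have Ib': "(\<integral>\<^sup>+x. b x \<partial>N) < top" "iB = (enn2real (J u) + enn2real (J v)) / 2"
    using grad(2)[OF uv(1)] grad(2)[OF uv(2)] Ib
    by (auto simp: iB_def ennreal_mult_less_top enn2real_mult enn2real_plus simp del: ennreal_half)
  have Ia: "(\<integral>\<^sup>+x. a x \<partial>N) < top"
    using nn_integral_mono[of N a b] ab Ib'(1) le_less_trans by blast
  have "AE x in N. a x = b x"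
  proof (rule AE_eq_of_nn_integral_le)
    have "enn2real (J z) \<le> iA"
      unfolding iA_def a_def
    proof (rule J_le)
      show "AE x in N. min_gradient \<Omega> \<mu> p z x \<le> ennreal (1 / 2) * (?gu x + ?gv x)"
        using mean.min_gradient_comb_le[OF uv(1,2)[unfolded V_def]] unfolding z_def N_def .
      show "(\<integral>\<^sup>+x. ennpowr (ennreal (1 / 2) * (?gu x + ?gv x)) p \<partial>N) < top"
        using Ia by (simp only: a_def)
    qed
    \<comment> \<open>The common minimal energy equals \<open>iB + B z\<close>, the average of the
      energies of \<open>u\<close> and \<open>v\<close>, while the energy of \<open>z\<close> is at
      most \<open>iA + B z\<close>.\<close>
    then have "iB \<le> iA"
      using min(1)[OF z Iz] eq Bz Ib'(2) by argo
    then show "(\<integral>\<^sup>+x. b x \<partial>N) \<le> (\<integral>\<^sup>+x. a x \<partial>N)"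
      using Ia Ib'(1) unfolding iA_def iB_def by (metis ennreal_enn2real ennreal_leI)
  qed (use ab Ia in auto)
  moreover have "AE x in N. ?gu x < top" "AE x in N. ?gv x < top"
  proof -
    have "AE x in N. min_gradient \<Omega> \<mu> p w x < top" if "w \<in> V" for w
    proof -
      have "AE x in N. ennpowr (min_gradient \<Omega> \<mu> p w x) p \<noteq> \<infinity>"
        using grad[OF that] by (intro nn_integral_PInf_AE) (auto simp: J_def)
      then show ?thesis
        by eventually_elim (metis ennpowr_top infinity_ennreal_def top.not_eq_extremum)
    qed
    then show "AE x in N. ?gu x < top" "AE x in N. ?gv x < top" using uv by auto
  qed
  ultimately have guv: "AE x in N. ?gu x = ?gv x"
    by eventually_elim (use ennpowr_midpoint_eqD[OF assms(1)] in \<open>auto simp: a_def b_def\<close>)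
  then have Juv: "J u = J v"
    unfolding J_def by (intro nn_integral_cong_AE) (auto elim: eventually_mono)
  with eq have Buv: "B u = B v" by simp

  define cM where "cM = mean \<mu> \<Omega> (\<lambda>y. max (u y) (v y))"
  define cm where "cm = mean \<mu> \<Omega> (\<lambda>y. min (u y) (v y))"
  define wM where "wM x = max (u x) (v x) - ereal cM" for x
  define wm where "wm x = min (u x) (v x) - ereal cm" for x
  interpret upper: gradient_combination \<mu> \<Omega> p "\<lambda>a b. max a b - ereal c" max "\<bar>c\<bar>" for c
    by (rule gradient_combination_max[OF sets p(1) fin'])
  interpret lower: gradient_combination \<mu> \<Omega> p "\<lambda>a b. min a b - ereal c" max "\<bar>c\<bar>" for c
    by (rule gradient_combination_min[OF sets p(1) fin'])
  have w: "wM \<in> V" "wm \<in> V"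
    using upper.newtonian_comb[OF uv(1,2)[unfolded V_def]] lower.newtonian_comb[OF uv(1,2)[unfolded V_def]]
    unfolding wM_def wm_def V_def by auto
  have mx: "(\<lambda>x. max (u x) (v x)) \<in> V" "(\<lambda>x. min (u x) (v x)) \<in> V"
    using upper.newtonian_comb[OF uv(1,2)[unfolded V_def], of 0] lower.newtonian_comb[OF uv(1,2)[unfolded V_def], of 0]
    unfolding V_def by (auto simp flip: zero_ereal_def)
  have c: "cM * measure \<mu> \<Omega> = I (\<lambda>x. max (u x) (v x))" "cm * measure \<mu> \<Omega> = I (\<lambda>x. min (u x) (v x))"
    using mass'(1) by (simp_all add: cM_def cm_def mean_def I_def)
  \<comment> \<open>The term with coefficient 0 only fills the second slot of \<open>I_lin\<close>;
    in \<open>ereal\<close> it vanishes even where \<open>u\<close> is infinite.\<close>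
  have "I wM = 1 * I (\<lambda>x. max (u x) (v x)) + 0 * I u + - cM * measure \<mu> \<Omega>"
    by (rule I_lin[OF w(1) mx(1) uv(1)]) (simp add: wM_def minus_ereal_def flip: zero_ereal_def one_ereal_def)
  moreover have "I wm = 1 * I (\<lambda>x. min (u x) (v x)) + 0 * I u + - cm * measure \<mu> \<Omega>"
    by (rule I_lin[OF w(2) mx(2) uv(1)]) (simp add: wm_def minus_ereal_def flip: zero_ereal_def one_ereal_def)
  ultimately have Iw: "I wM = 0" "I wm = 0" using c by auto
  \<comment> \<open>Maximum and minimum merely reorder the two summands of \<open>z\<close>, so this
    decomposition holds at every point, infinite values included.\<close>
  have "I z = 1 / 2 * I (\<lambda>x. max (u x) (v x)) + 1 / 2 * I (\<lambda>x. min (u x) (v x)) + 0 * measure \<mu> \<Omega>"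
    by (rule I_lin[OF z mx])
      (auto simp: z_def max_def min_def add.commute simp flip: zero_ereal_def)
  then have "(cM + cm) * measure \<mu> \<Omega> = 0" using Iz c by (simp add: distrib_right)
  \<comment> \<open>The means cancel, so \<open>wM + wm = u + v\<close> and the trace of constants is not needed.\<close>
  then have cc: "cm = - cM" using mass'(1) by simp
  have "B z = 1 / 2 * B wM + 1 / 2 * B wm"
  proof (rule B_lin[OF z w])
    show "AE x in N. z x = ereal (1 / 2) * wM x + ereal (1 / 2) * wm x"
      using VN(1)[OF uv(1)] VN(1)[OF uv(2)]
    proof eventually_elim
      case (elim x)
      then obtain r t where "u x = ereal r" "v x = ereal t" by auto
      then show ?case by (auto simp: z_def wM_def wm_def cc max_def min_def field_simps)
    qed
  qed
  then have Bw: "B wM + B wm = 2 * B u" using Bz Buv by simp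
  have gw: "AE x in N. min_gradient \<Omega> \<mu> p wM x \<le> ?gu x" "AE x in N. min_gradient \<Omega> \<mu> p wm x \<le> ?gu x"
  proof -
    show "AE x in N. min_gradient \<Omega> \<mu> p wM x \<le> ?gu x"
      using upper.min_gradient_comb_le[OF uv(1,2)[unfolded V_def], of cM] guv
      unfolding wM_def N_def by eventually_elim simp
    show "AE x in N. min_gradient \<Omega> \<mu> p wm x \<le> ?gu x"
      using lower.min_gradient_comb_le[OF uv(1,2)[unfolded V_def], of cm] guv
      unfolding wm_def N_def by eventually_elim simp
  qed
  have "enn2real (J wM) \<le> enn2real (J u)" "enn2real (J wm) \<le> enn2real (J u)"
    using J_le[OF gw(1)] J_le[OF gw(2)] grad(2)[OF uv(1)] by (auto simp: J_def)
  \<comment> \<open>The two energies add up to at most twice the minimum and neither is below it, so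
    neither is above it.\<close>
  then have "enn2real (J wM) + B wM \<le> enn2real (J u) + B u" "enn2real (J wm) + B wm \<le> enn2real (J u) + B u"
    using Bw min(1)[OF w(1) Iw(1)] min(1)[OF w(2) Iw(2)] by linarith+
  then have "wM \<in> minimizers \<mu> \<Omega> p T f" "wm \<in> minimizers \<mu> \<Omega> p T f"
    using min(1) w Iw order_trans
    unfolding minimizers_iff newtonian_mean_zero_def energy V_def I_def by blast+
  then show ?thesis
    using Buv guv unfolding B_def N_def wM_def wm_def cM_def cm_def by blast
qed

end
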